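(* Let $d,\ell,m\in\mathbb{N}$. Let $\mathcal{P}$ be a family of polytopes in $\mathbb{R}^d$ of dimensions at least one with $2\le|\mathcal{P}|<\infty$ such that each $P\in\mathcal{P}$ has an extended formulation with $\ell$ LMIs of size $m$. Let $\rho>0$ and $\Delta>0$ be such that each $P\in\mathcal{P}$ is contained in the ball $\rho\mathbb{B}^d$ and, for every two distinct polytopes $P\in\mathcal{P}$ and $P'\in\mathcal{P}$, one has $\operatorname{dist}(P,P')\ge\Delta$. Then $$\ell^2m^4\ \ge\ \frac{\log|\mathcal{P}|}{8d\left(1+\log(2\rho/\Delta)+\log\log|\mathcal{P}|\right)}=:B.$$ In particular, we have $$\max_{P\in\mathcal{P}}\operatorname{sxc}(P)\ge\sqrt[4]{B}\qquad\text{and}\qquad\max_{P\in\mathcal{P}}\operatorname{xc}(P)\ge\sqrt{B}.$$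
   Context: $\mathbb{N}=\{1,2,3,\ldots\}$ and $\log$ is the logarithm to base $2$. $\|\cdot\|$ is the Euclidean norm on $\mathbb{R}^d$ and $\mathbb{B}^d=\{x\in\mathbb{R}^d:\|x\|\le1\}$. For non-empty compact sets $X,Y\subseteq\mathbb{R}^d$, $\operatorname{dist}(X,Y)=\max\{\sup_{x\in X}\inf_{y\in Y}\|x-y\|,\ \sup_{y\in Y}\inf_{x\in X}\|x-y\|\}$ is the Hausdorff distance. $\mathcal{S}^k$ is the space of real symmetric $k\times k$ matrices and $\mathcal{S}^k_+$ the cone of positive semidefinite matrices in it. A set $P\subseteq\mathbb{R}^d$ has an extended formulation with an LMI of size $k$ if there exist $n\in\mathbb{N}$ and affine maps $\varphi:\mathbb{R}^n\to\mathbb{R}^d$ and $M:\mathbb{R}^n\to\mathcal{S}^k$ such that $P=\varphi(Q)$ with $Q=\{x\in\mathbb{R}^n:M(x)\in\mathcal{S}^k_+\}$. It is an extended formulation with $\ell$ LMIs of size $m$ if moreover $k=\ell m$ and $M(x)$ is block-diagonal with diagonal blocks $M_1(x),\ldots,M_\ell(x)$, where $M_1,\ldots,M_\ell:\mathbb{R}^n\to\mathcal{S}^m$ (so that $Q=\{x:M_1(x),\ldots,M_\ell(x)\in\mathcal{S}^m_+\}$). An extended formulation with $\ell$ LMIs of size $m=1$ is called an extended formulation with $\ell$ linear inequalities. For a polytope $P$, the semidefinite extension complexity $\operatorname{sxc}(P)$ is the smallest $k$ such that $P$ has an extended formulation with an LMI of size $k$; the linear extension complexity $\operatorname{xc}(P)$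 is the smallest $\ell$ such that $P$ has an extended formulation with $\ell$ linear inequalities. If $P$ is empty or a single point, $\operatorname{sxc}(P)=\operatorname{xc}(P)=0$. *)

theory Defs
  imports "HOL-Analysis.Analysis" "Jordan_Normal_Form.Matrix"
begin

(* The ambient space R^d of the polytopes is real ^ 'd. The lifted space R^n and the size k of
   the matrices are existentially quantified inside the definitions below, so R^n and S^k are
   rendered by carriers of the dimension-indexed vectors and matrices of Jordan_Normal_Form. *)

definition sym_mats :: "nat \<Rightarrow> real mat set" where
  "sym_mats k = {A \<in> carrier_mat k k. transpose_mat A = A}"

definition psd_mats :: "nat \<Rightarrow> real mat set" where
  "psd_mats k = {A \<in> sym_mats k. \<forall>v \<in> carrier_vec k. 0 \<le> scalar_prod v (A *\<^sub>v v)}"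

(* Affine maps on R^n, as maps preserving affine combinations of points of carrier_vec n. The
   type real mat is not a vector space type (it mixes dimensions), hence two versions. *)

definition affine_vec_map :: "nat \<Rightarrow> (real Matrix.vec \<Rightarrow> real ^ 'd) \<Rightarrow> bool" where
  "affine_vec_map n \<phi> \<longleftrightarrow>
     (\<forall>x \<in> carrier_vec n. \<forall>y \<in> carrier_vec n. \<forall>t.
        \<phi> ((1 - t) \<cdot>\<^sub>v x + t \<cdot>\<^sub>v y) = (1 - t) *\<^sub>R \<phi> x + t *\<^sub>R \<phi> y)"

definition affine_mat_map :: "nat \<Rightarrow> nat \<Rightarrow> (real Matrix.vec \<Rightarrow> real mat) \<Rightarrow> bool" where
  "affine_mat_map n k M \<longleftrightarrow>
     M \<in> carrier_vec n \<rightarrow> sym_mats k \<and>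
     (\<forall>x \<in> carrier_vec n. \<forall>y \<in> carrier_vec n. \<forall>t.
        M ((1 - t) \<cdot>\<^sub>v x + t \<cdot>\<^sub>v y) = (1 - t) \<cdot>\<^sub>m M x + t \<cdot>\<^sub>m M y)"

definition extended_formulation ::
  "nat \<Rightarrow> nat \<Rightarrow> (real Matrix.vec \<Rightarrow> real ^ 'd) \<Rightarrow> (real Matrix.vec \<Rightarrow> real mat) \<Rightarrow> (real ^ 'd) set \<Rightarrow> bool"
  where
  "extended_formulation n k \<phi> M P \<longleftrightarrow>
     affine_vec_map n \<phi> \<and> affine_mat_map n k M \<and>
     P = \<phi> ` {x \<in> carrier_vec n. M x \<in> psd_mats k}"

definition has_ef_LMI :: "(real ^ 'd) set \<Rightarrow> nat \<Rightarrow> bool" where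
  "has_ef_LMI P k \<longleftrightarrow> (\<exists>n \<ge> 1. \<exists>\<phi> M. extended_formulation n k \<phi> M P)"

definition has_ef_LMIs :: "(real ^ 'd) set \<Rightarrow> nat \<Rightarrow> nat \<Rightarrow> bool" where
  "has_ef_LMIs P l m \<longleftrightarrow>
     (\<exists>n \<ge> 1. \<exists>\<phi> M Ms. extended_formulation n (l * m) \<phi> M P \<and>
        (\<forall>i < l. Ms i \<in> carrier_vec n \<rightarrow> sym_mats m) \<and>
        (\<forall>x \<in> carrier_vec n. M x = diag_block_mat (map (\<lambda>i. Ms i x) [0..<l])))"

(* Only meaningful for polytopes: every polytope has an extended formulation with finitely many
   linear inequalities, so the minima below are attained. *)

definition sxc :: "(real ^ 'd) set \<Rightarrow> nat" where
  "sxc P = (if P = {} \<or> (\<exists>p. P = {p}) then 0 else LEAST k. 1 \<le> k \<and> has_ef_LMI P k)"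

definition xc :: "(real ^ 'd) set \<Rightarrow> nat" where
  "xc P = (if P = {} \<or> (\<exists>p. P = {p}) then 0 else LEAST l. 1 \<le> l \<and> has_ef_LMIs P l 1)"

(* Intended for non-empty compact sets, where the suprema and infima are over non-empty bounded
   sets of reals; infdist x Y is the infimum of dist x y over y in Y. *)

definition hausdorff_dist :: "(real ^ 'd) set \<Rightarrow> (real ^ 'd) set \<Rightarrow> real" where
  "hausdorff_dist X Y = max (SUP x \<in> X. infdist x Y) (SUP y \<in> Y. infdist y X)"

end

theory Submission
  imports Defs "Jordan_Normal_Form.Determinant"
begin

text \<open>
  Each polytope \<open>P\<close> is encoded by boundedly many bounded real parameters such that close parameters
  force a small Hausdorff distance; counting the cells of a grid then bounds the number of polytopes.

  To normalize a formulation, pick preimages of the vertices of \<open>P\<close> and let \<open>A v\<close> be the matrices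
  at these points. Write every block of every \<open>A v\<close> as a sum of squares of vectors and choose, among
  these finitely many vectors, a spanning family of maximal volume (a barycentric spanner): all of
  the vectors have coordinates in \<open>[-1, 1]\<close> with respect to it. In these coordinates the blocks have
  entries of size at most \<open>m\<close>, and the average of the at most \<open>l m\<close> vertex matrices containing the
  spanning vectors is at least \<open>1 / (l m)\<close> times the identity. A second spanner, now among the
  matrices themselves, selects at most \<open>N = l m\<^sup>2\<close> vertices such that each point of \<open>P\<close> is an affine
  combination of them with coefficients in \<open>[-1, 1]\<close> whose matrix is positive semidefinite. The
  coefficients sum to one because \<open>0\<close> is not in the affine hull of the matrices: otherwise the
  feasible set would be a cone and the bounded set \<open>P\<close> a point. When the data of \<open>P\<close> are perturbed,
  a small shift of the coefficients towards those of the average restores feasibility.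

  This replaces the maximum volume ellipsoids of the classical argument by finite choices.
\<close>

section \<open>Barycentric spanners and sums of squares\<close>

lemma barycentric_spanner_coords:
  fixes f :: "'i \<Rightarrow> nat \<Rightarrow> real"
  assumes "finite I"
  shows "\<exists>n e coef. n \<le> N \<and> e ` {..<n} \<subseteq> I \<and>
    (\<forall>i\<in>I. \<forall>r<N. f i r = (\<Sum>p<n. coef i p * f (e p) r)) \<and>
    (\<forall>i\<in>I. \<forall>p<n. \<bar>coef i p\<bar> \<le> 1) \<and>
    (\<forall>p<n. \<forall>q<n. coef (e p) q = (if p = q then 1 else 0))"
proof -
  txt \<open>
    The family need not span the whole space, so candidates may also contain unit vectors (\<open>Inr\<close>).
    Among the bases we maximize first the number of family members and then the absolute value of the
    determinant: by Cramer's rule, coefficients at unit vectors vanish and the others are at most 1.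
  \<close>
  define g where "g s = (case s of Inl i \<Rightarrow> f i | Inr q \<Rightarrow> (\<lambda>r. if r = q then 1 else 0))" for s :: "'i + nat"
  define A where "A \<sigma> = mat N N (\<lambda>(r, c). g (\<sigma> c) r)" for \<sigma>
  define D where "D \<sigma> = Determinant.det (A \<sigma>)" for \<sigma>
  define cnt where "cnt \<sigma> = card {c. c < N \<and> isl (\<sigma> c)}" for \<sigma> :: "nat \<Rightarrow> 'i + nat"
  define T where "T = {..<N} \<rightarrow>\<^sub>E (Inl ` I \<union> Inr ` {..<N})"
  define T0 where "T0 = {\<sigma> \<in> T. D \<sigma> \<noteq> 0}"
  have A_carr [simp]: "A \<sigma> \<in> carrier_mat N N" for \<sigma> by (simp add: A_def)
  have "finite T" unfolding T_def by (intro finite_PiE) (auto simp: assms)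
  then have fin0: "finite T0" by (simp add: T0_def)
  \<comment> \<open>The standard basis is always a candidate, so \<open>T0\<close> is nonempty and
    both maxima exist.\<close>
  define \<sigma>0 where "\<sigma>0 = (\<lambda>c\<in>{..<N}. Inr c :: 'i + nat)"
  have "A \<sigma>0 = 1\<^sub>m N" by (rule eq_matI) (auto simp: A_def g_def \<sigma>0_def)
  then have "\<sigma>0 \<in> T0" by (auto simp: T0_def D_def T_def \<sigma>0_def)
  then have ne0: "T0 \<noteq> {}" by auto
  define k where "k = Max (cnt ` T0)"
  have cnt_le: "cnt \<sigma> \<le> k" if "\<sigma> \<in> T0" for \<sigma>
    unfolding k_def using fin0 that by simp
  define T1 where "T1 = {\<sigma> \<in> T0. cnt \<sigma> = k}"
  have "k \<in> cnt ` T0" unfolding k_def using fin0 ne0 by (intro Max_in) auto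
  then have "T1 \<noteq> {}" by (auto simp: T1_def)
  moreover have fin1: "finite T1" using fin0 by (simp add: T1_def)
  ultimately have "Max ((\<lambda>\<sigma>. \<bar>D \<sigma>\<bar>) ` T1) \<in> (\<lambda>\<sigma>. \<bar>D \<sigma>\<bar>) ` T1" by (intro Max_in) auto
  then obtain \<sigma> where \<sigma>: "\<sigma> \<in> T1" and "\<bar>D \<sigma>\<bar> = Max ((\<lambda>\<sigma>. \<bar>D \<sigma>\<bar>) ` T1)" by auto
  then have D_max: "\<bar>D \<tau>\<bar> \<le> \<bar>D \<sigma>\<bar>" if "\<tau> \<in> T1" for \<tau>
    using fin1 that by simp
  have \<sigma>T: "\<sigma> \<in> T" and D\<sigma>: "D \<sigma> \<noteq> 0" and cnt\<sigma>: "cnt \<sigma> = k" using \<sigma> by (auto simp: T1_def T0_def)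
  \<comment> \<open>Cramer's quotient: the coordinate of \<open>f i\<close> along column
    \<open>c\<close> of the optimal basis.\<close>
  define x where "x i c = D (\<sigma>(c := Inl i)) / D \<sigma>" for i c
  have upd_T: "\<sigma>(c := Inl i) \<in> T" if "i \<in> I" "c < N" for i c
    using \<sigma>T that unfolding T_def PiE_iff by (auto simp: extensional_def)
  have expand: "f i r = (\<Sum>c<N. x i c * g (\<sigma> c) r)" if "r < N" for i r
  proof -
    define b where "b = Matrix.vec N (f i)"
    \<comment> \<open>The solution of the linear system with matrix \<open>A \<sigma>\<close> and
      right side \<open>b\<close>, by the adjugate; \<open>cramer_lemma_mat\<close> then identifies
      its entries with the quotients \<open>x i c\<close>.\<close>
    define y where "y = (1 / D \<sigma>) \<cdot>\<^sub>v (adj_mat (A \<sigma>) *\<^sub>v b)"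
    have b: "b \<in> carrier_vec N" by (simp add: b_def)
    have y: "y \<in> carrier_vec N" unfolding y_def
      using adj_mat(1)[OF A_carr] b by (metis smult_carrier_vec mult_mat_vec_carrier)
    have "A \<sigma> *\<^sub>v y = (1 / D \<sigma>) \<cdot>\<^sub>v (A \<sigma> *\<^sub>v (adj_mat (A \<sigma>) *\<^sub>v b))"
      unfolding y_def
      using mult_mat_vec[OF A_carr mult_mat_vec_carrier[OF adj_mat(1)[OF A_carr] b]] .
    also have "A \<sigma> *\<^sub>v (adj_mat (A \<sigma>) *\<^sub>v b) = (A \<sigma> * adj_mat (A \<sigma>)) *\<^sub>v b"
      using assoc_mult_mat_vec[OF A_carr adj_mat(1)[OF A_carr] b] by simp
    also have "A \<sigma> * adj_mat (A \<sigma>) = D \<sigma> \<cdot>\<^sub>m 1\<^sub>m N"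
      unfolding D_def by (rule adj_mat(2)[OF A_carr])
    also have "(1 / D \<sigma>) \<cdot>\<^sub>v ((D \<sigma> \<cdot>\<^sub>m 1\<^sub>m N) *\<^sub>v b) = b"
      using b D\<sigma> by (intro eq_vecI) auto
    finally have Ay: "A \<sigma> *\<^sub>v y = b" .
    have yx: "vec_index y c = x i c" if "c < N" for c
    proof -
      have "replace_col (A \<sigma>) b c = A (\<sigma>(c := Inl i))"
        by (rule eq_matI) (auto simp: replace_col_def A_def b_def g_def)
      then have "D (\<sigma>(c := Inl i)) = vec_index y c * D \<sigma>"
        using cramer_lemma_mat[OF A_carr y that, of \<sigma>] by (simp add: Ay D_def)
      then show ?thesis using D\<sigma> by (simp add: x_def)
    qed
    have "f i r = vec_index (A \<sigma> *\<^sub>v y) r" using that by (simp add: Ay b_def)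
    also have "\<dots> = (\<Sum>c<N. g (\<sigma> c) r * vec_index y c)"
      using that y by (simp add: A_def scalar_prod_def lessThan_atLeast0)
    also have "\<dots> = (\<Sum>c<N. x i c * g (\<sigma> c) r)" by (intro sum.cong) (auto simp: yx)
    finally show ?thesis .
  qed
  \<comment> \<open>Exchanging one family member for another keeps the count, so the new choice
    competes with \<open>\<sigma>\<close> for the largest determinant, unless it is singular and the
    coefficient is 0.\<close>
  have bound: "\<bar>x i c\<bar> \<le> 1" if i: "i \<in> I" and c: "c < N" "isl (\<sigma> c)" for i c
  proof (cases "D (\<sigma>(c := Inl i)) = 0")
    case False
    have "{c'. c' < N \<and> isl ((\<sigma>(c := Inl i)) c')} = {c'. c' < N \<and> isl (\<sigma> c')}" using c by auto
    then have "\<sigma>(c := Inl i) \<in> T1"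
      using upd_T[OF i c(1)] False cnt\<sigma> unfolding T1_def T0_def cnt_def by simp
    from D_max[OF this] show ?thesis using D\<sigma> by (simp add: x_def)
  qed (simp add: x_def)
  \<comment> \<open>A nonzero coefficient at a unit vector would make the exchange nonsingular with
    one more family member, against the maximality of \<open>k\<close>.\<close>
  have zero: "x i c = 0" if i: "i \<in> I" and c: "c < N" "\<not> isl (\<sigma> c)" for i c
  proof (rule ccontr)
    assume "x i c \<noteq> 0"
    then have "\<sigma>(c := Inl i) \<in> T0" using upd_T[OF i c(1)] by (auto simp: T0_def x_def)
    moreover have "{c'. c' < N \<and> isl ((\<sigma>(c := Inl i)) c')} = insert c {c'. c' < N \<and> isl (\<sigma> c')}"
      using c by auto
    then have "cnt (\<sigma>(c := Inl i)) = Suc k" using c cnt\<sigma> by (simp add: cnt_def)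
    ultimately show False using cnt_le by fastforce
  qed
  \<comment> \<open>Two columns coincide. This is why the chosen members have unit coordinate
    vectors in \<open>x_e\<close>.\<close>
  have ident: "D (\<sigma>(c := \<sigma> c0)) = 0" if "c < N" "c0 < N" "c \<noteq> c0" for c c0
    unfolding D_def by (rule det_identical_columns[OF A_carr that(3,1,2)])
      (use that in \<open>auto intro!: eq_vecI simp: A_def\<close>)
  define C where "C = {c. c < N \<and> isl (\<sigma> c)}"
  have finC: "finite C" by (simp add: C_def)
  then obtain h where h: "bij_betw h {..<card C} C"
    using ex_bij_betw_nat_finite by (metis lessThan_atLeast0)
  define e where "e p = projl (\<sigma> (h p))" for p
  have hC: "h p < N" "\<sigma> (h p) = Inl (e p)" if "p < card C" for p
    using bij_betwE[OF h] that by (auto simp: C_def e_def)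
  have x_e: "x (e p) (h q) = (if p = q then 1 else 0)" if "p < card C" "q < card C" for p q
  proof (cases "p = q")
    case True
    then show ?thesis using D\<sigma> hC[OF that(1)]
      by (simp add: x_def) (metis fun_upd_triv)
  next
    case False
    then have "h q \<noteq> h p" using h that by (auto simp: bij_betw_def inj_on_def)
    then show ?thesis using False ident[OF hC(1)[OF that(2)] hC(1)[OF that(1)]] hC(2)[OF that(1)]
      by (simp add: x_def)
  qed
  show ?thesis
  proof (intro exI[of _ "card C"] exI[of _ e] exI[of _ "\<lambda>i p. x i (h p)"] conjI ballI allI impI)
    have "card C \<le> card {..<N}" by (intro card_mono) (auto simp: C_def)
    then show "card C \<le> N" by simp
    show "e ` {..<card C} \<subseteq> I"
    proof clarify
      fix p assume "p < card C"
      with hC[of p] \<sigma>T show "e p \<in> I" unfolding T_def PiE_iff by force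
    qed
    show "f i r = (\<Sum>p<card C. x i (h p) * f (e p) r)" if "i \<in> I" "r < N" for i r
    proof -
      have "f i r = (\<Sum>c\<in>C. x i c * g (\<sigma> c) r)"
        unfolding expand[OF that(2)]
        by (intro sum.mono_neutral_right) (auto simp: C_def zero that(1))
      also have "\<dots> = (\<Sum>p<card C. x i (h p) * g (\<sigma> (h p)) r)"
        by (rule sum.reindex_bij_betw[OF h, symmetric])
      also have "\<dots> = (\<Sum>p<card C. x i (h p) * f (e p) r)"
        by (intro sum.cong) (auto simp: hC g_def)
      finally show ?thesis .
    qed
    show "\<bar>x i (h p)\<bar> \<le> 1" if "i \<in> I" "p < card C" for i p
      using bound[OF that(1) hC(1)[OF that(2)]] hC(2)[OF that(2)] by simp
  qed (use x_e in auto)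
qed

text \<open>An enumeration of \<open>K\<close> reduces this to coordinates below
  \<open>card K\<close>; later \<open>K\<close> consists of triples that index the entries of
  several blocks.\<close>

lemma barycentric_spanner:
  fixes f :: "'i \<Rightarrow> 'k \<Rightarrow> real"
  assumes "finite I" "finite K"
  obtains n e coef where "n \<le> card K" "e ` {..<n} \<subseteq> I"
    "\<And>i r. i \<in> I \<Longrightarrow> r \<in> K \<Longrightarrow> f i r = (\<Sum>p<n. coef i p * f (e p) r)"
    "\<And>i p. i \<in> I \<Longrightarrow> p < n \<Longrightarrow> \<bar>coef i p\<bar> \<le> 1"
    "\<And>p q. p < n \<Longrightarrow> q < n \<Longrightarrow> coef (e p) q = (if p = q then 1 else 0)"
proof -
  obtain h where h: "bij_betw h {..<card K} K"
    using ex_bij_betw_nat_finite[OF assms(2)] by (metis lessThan_atLeast0)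
  obtain n e coef where *: "n \<le> card K" "e ` {..<n} \<subseteq> I"
    "\<forall>i\<in>I. \<forall>r<card K. f i (h r) = (\<Sum>p<n. coef i p * f (e p) (h r))"
    "\<forall>i\<in>I. \<forall>p<n. \<bar>coef i p\<bar> \<le> 1" "\<forall>p<n. \<forall>q<n. coef (e p) q = (if p = q then 1 else 0)"
    using barycentric_spanner_coords[OF assms(1), of "card K" "\<lambda>i r. f i (h r)"] by blast
  show ?thesis
  proof (rule that[OF *(1,2)])
    show "f i r = (\<Sum>p<n. coef i p * f (e p) r)" if ir: "i \<in> I" "r \<in> K" for i r
    proof -
      obtain r' where "r' < card K" "r = h r'" using h ir(2) by (auto simp: bij_betw_def)
      then show ?thesis using * ir by auto
    qed
  qed (use * in auto)
qed

section \<open>Quadratic forms and sums of squares\<close>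

text \<open>Matrices are plain functions here, read only at indices below \<open>m\<close>, so that
  linear combinations of them need no dimension side conditions.\<close>

definition qform :: "nat \<Rightarrow> (nat \<Rightarrow> nat \<Rightarrow> real) \<Rightarrow> (nat \<Rightarrow> real) \<Rightarrow> real" where
  "qform m A v = (\<Sum>a<m. \<Sum>b<m. v a * A a b * v b)"

text \<open>Induction by Schur complement: the last column, divided by the root of the last diagonal
  entry \<alpha>, is one of the vectors, and the complement of size \<open>m\<close> supplies the
  others. If \<alpha> is 0, the last column vanishes by semidefiniteness.\<close>

lemma psd_sum_of_squares:
  assumes "\<And>a b. a < m \<Longrightarrow> b < m \<Longrightarrow> A a b = A b a" "\<And>v. 0 \<le> qform m A v"
  shows "\<exists>c :: nat \<Rightarrow> nat \<Rightarrow> real. \<forall>a<m. \<forall>b<m. A a b = (\<Sum>j<m. c j a * c j b)"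
  using assms
proof (induction m arbitrary: A)
  case (Suc m)
  define \<alpha> where "\<alpha> = A m m"
  have sym: "A a b = A b a" if "a \<le> m" "b \<le> m" for a b using Suc.prems(1) that by simp
  have split: "qform (Suc m) A v = qform m A v + 2 * v m * (\<Sum>a<m. v a * A a m) + \<alpha> * (v m)\<^sup>2" for v
  proof -
    have "(\<Sum>b<m. v m * A m b * v b) = v m * (\<Sum>a<m. v a * A a m)"
      unfolding sum_distrib_left by (intro sum.cong) (auto simp: sym)
    moreover have "(\<Sum>a<m. v a * A a m * v m) = v m * (\<Sum>a<m. v a * A a m)"
      unfolding sum_distrib_left by (intro sum.cong) auto
    ultimately show ?thesis
      by (simp add: qform_def sum.distrib \<alpha>_def power2_eq_square)
  qed
  have "0 \<le> qform (Suc m) A (\<lambda>a. if a = m then 1 else 0)" by (rule Suc.prems)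
  then have "0 \<le> \<alpha>" unfolding split by (simp add: qform_def)
  \<comment> \<open>The Schur complement of \<alpha>. As division by zero gives 0, \<open>B\<close>
    equals \<open>A\<close> when \<alpha> is 0, so no separate definition is needed for that
    case.\<close>
  define B where "B a b = A a b - A a m * A b m / \<alpha>" for a b
  have qB: "qform m B v = qform m A v - (\<Sum>a<m. v a * A a m)\<^sup>2 / \<alpha>" for v
    unfolding B_def qform_def power2_eq_square sum_product
    by (simp add: sum_subtractf sum_divide_distrib algebra_simps)
  have qB_nonneg: "0 \<le> qform m B v" for v
  proof (cases "\<alpha> = 0")
    case True
    have "0 \<le> qform (Suc m) A (v(m := 0))" by (rule Suc.prems)
    moreover have "qform m A (v(m := 0)) = qform m A v" by (simp add: qform_def)
    ultimately show ?thesis unfolding split qB using True by simp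
  next
    case False
    define s where "s = (\<Sum>a<m. v a * A a m)"
    \<comment> \<open>This last coordinate minimizes the form for fixed remaining coordinates; the
      minimum is the form of \<open>B\<close>.\<close>
    have "0 \<le> qform (Suc m) A (v(m := - s / \<alpha>))" by (rule Suc.prems)
    moreover have "qform m A (v(m := - s / \<alpha>)) = qform m A v" by (simp add: qform_def)
    moreover have "(\<Sum>a<m. (v(m := - s / \<alpha>)) a * A a m) = s" by (simp add: s_def)
    ultimately show ?thesis unfolding split qB s_def[symmetric] using False
      by (simp add: field_simps power2_eq_square)
  qed
  have "\<exists>c. \<forall>a<m. \<forall>b<m. B a b = (\<Sum>j<m. c j a * c j b)"
    by (rule Suc.IH[OF _ qB_nonneg]) (simp add: B_def sym mult.commute)
  then obtain c where c: "\<And>a b. a < m \<Longrightarrow> b < m \<Longrightarrow> B a b = (\<Sum>j<m. c j a * c j b)"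
    by blast
  have zero_col: "A a m = 0" if "\<alpha> = 0" "a < m" for a
  proof (rule ccontr)
    assume nz: "A a m \<noteq> 0"
    \<comment> \<open>With \<alpha> equal to 0 the form is \<open>A a a + 2 * t * A a m\<close> at
      the vector \<open>v\<close> below, linear in \<open>t\<close>; this \<open>t\<close> makes it
      -1.\<close>
    define t where "t = - (A a a + 1) / (2 * A a m)"
    define v where "v = (\<lambda>b. if b = m then t else if b = a then 1 else 0)"
    have pick: "(\<Sum>b<m. v b * h b) = h a" for h
    proof -
      have "(\<Sum>b<m. v b * h b) = (\<Sum>b<m. if b = a then h b else 0)"
        by (intro sum.cong) (auto simp: v_def)
      then show ?thesis using that(2) by simp
    qed
    have "qform m A v = A a a"
      unfolding qform_def mult.assoc sum_distrib_left[symmetric]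
      by (simp only: pick mult.commute[of "A a _"])
    moreover have "(\<Sum>b<m. v b * A b m) = A a m" by (rule pick)
    ultimately have "qform (Suc m) A v = A a a + 2 * t * A a m"
      unfolding split by (simp add: v_def \<open>\<alpha> = 0\<close>)
    also have "\<dots> = -1" using nz by (simp add: t_def field_simps)
    finally show False using Suc.prems(2)[of v] by simp
  qed
  define c' where "c' j a = (if j = m then A a m / sqrt \<alpha> else if a = m then 0 else c j a)" for j a
  have last: "c' m a * c' m b = A a m * A b m / \<alpha>" for a b
    using \<open>0 \<le> \<alpha>\<close> by (simp add: c'_def)
  have "A a b = (\<Sum>j<Suc m. c' j a * c' j b)" if ab: "a < Suc m" "b < Suc m" for a b
  proof -
    consider "a < m" "b < m" | "a = m" | "b = m" using ab by (auto simp: less_Suc_eq)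
    then show ?thesis
    proof cases
      case 1
      then have "(\<Sum>j<m. c' j a * c' j b) = B a b" using c by (simp add: c'_def)
      then show ?thesis using 1 by (simp add: last B_def)
    next
      case 2
      then have "A a b = A b m" using sym[of a b] ab by simp
      moreover have "\<alpha> = 0 \<Longrightarrow> A b m = 0"
        using zero_col[of b] ab(2) by (auto simp: \<alpha>_def less_Suc_eq)
      moreover have "(\<Sum>j<m. c' j a * c' j b) = 0" using 2 by (simp add: c'_def)
      moreover have "A a m = \<alpha>" using 2 by (simp add: \<alpha>_def)
      ultimately show ?thesis by (cases "\<alpha> = 0") (simp_all add: last)
    next
      case 3
      moreover have "\<alpha> = 0 \<Longrightarrow> A a m = 0"
        using zero_col[of a] ab(1) by (auto simp: \<alpha>_def less_Suc_eq)
      moreover have "(\<Sum>j<m. c' j a * c' j b) = 0" using 3 by (simp add: c'_def)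
      moreover have "A b m = \<alpha>" using 3 by (simp add: \<alpha>_def)
      ultimately show ?thesis by (cases "\<alpha> = 0") (simp_all add: last)
    qed
  qed
  then show ?case by blast
qed simp

section \<open>Block formulations\<close>

lemma scalar_prod_qform:
  assumes "A \<in> carrier_mat m m"
  shows "scalar_prod (Matrix.vec m v) (A *\<^sub>v Matrix.vec m v) = qform m (\<lambda>a b. A $$ (a, b)) v"
proof -
  have "scalar_prod (Matrix.vec m v) (A *\<^sub>v Matrix.vec m v) = (\<Sum>a<m. v a * (\<Sum>b<m. A $$ (a, b) * v b))"
    using assms by (simp add: scalar_prod_def lessThan_atLeast0)
  then show ?thesis by (simp add: qform_def sum_distrib_left mult.assoc)
qed

lemma sym_mats_iff:
  "A \<in> sym_mats m \<longleftrightarrow> A \<in> carrier_mat m m \<and> (\<forall>a<m. \<forall>b<m. A $$ (a, b) = A $$ (b, a))"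
  unfolding sym_mats_def by (auto simp: mat_eq_iff)

lemma psd_mats_iff:
  "A \<in> psd_mats m \<longleftrightarrow> A \<in> sym_mats m \<and> (\<forall>v. 0 \<le> qform m (\<lambda>a b. A $$ (a, b)) v)"
proof -
  have "(\<forall>v\<in>carrier_vec m. 0 \<le> scalar_prod v (A *\<^sub>v v)) \<longleftrightarrow> (\<forall>v. 0 \<le> qform m (\<lambda>a b. A $$ (a, b)) v)"
    if A: "A \<in> carrier_mat m m"
  proof
    assume *: "\<forall>v. 0 \<le> qform m (\<lambda>a b. A $$ (a, b)) v"
    show "\<forall>v\<in>carrier_vec m. 0 \<le> scalar_prod v (A *\<^sub>v v)"
    proof
      fix v :: "real Matrix.vec" assume "v \<in> carrier_vec m"
      then have "v = Matrix.vec m (vec_index v)" by auto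
      then show "0 \<le> scalar_prod v (A *\<^sub>v v)" using * scalar_prod_qform[OF A] by metis
    qed
  next
    assume *: "\<forall>v\<in>carrier_vec m. 0 \<le> scalar_prod v (A *\<^sub>v v)"
    show "\<forall>v. 0 \<le> qform m (\<lambda>a b. A $$ (a, b)) v"
      by (metis * scalar_prod_qform[OF A] vec_carrier)
  qed
  then show ?thesis unfolding psd_mats_def sym_mats_def by auto
qed

text \<open>Coordinates of \<open>\<phi>\<close> and entries of the matrices are both of this kind,
  which lets one point serve all of them simultaneously in
  \<open>affine_combination\<close>.\<close>

definition affine_fun :: "nat \<Rightarrow> (real Matrix.vec \<Rightarrow> real) \<Rightarrow> bool" where
  "affine_fun n h \<longleftrightarrow> (\<forall>x \<in> carrier_vec n. \<forall>y \<in> carrier_vec n. \<forall>t.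
     h ((1 - t) \<cdot>\<^sub>v x + t \<cdot>\<^sub>v y) = (1 - t) * h x + t * h y)"

lemma affine_vec_map_iff: "affine_vec_map n \<phi> \<longleftrightarrow> (\<forall>c. affine_fun n (\<lambda>x. vec_nth (\<phi> x) c))"
  unfolding affine_vec_map_def affine_fun_def
  by (auto simp: Finite_Cartesian_Product.vec_eq_iff)

lemma affine_mat_map_iff:
  "affine_mat_map n k M \<longleftrightarrow>
    (\<forall>x\<in>carrier_vec n. M x \<in> sym_mats k) \<and> (\<forall>a<k. \<forall>b<k. affine_fun n (\<lambda>x. M x $$ (a, b)))"
proof -
  have "M ((1 - t) \<cdot>\<^sub>v x + t \<cdot>\<^sub>v y) = (1 - t) \<cdot>\<^sub>m M x + t \<cdot>\<^sub>m M y \<longleftrightarrow>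
      (\<forall>a<k. \<forall>b<k. M ((1 - t) \<cdot>\<^sub>v x + t \<cdot>\<^sub>v y) $$ (a, b) = (1 - t) * M x $$ (a, b) + t * M y $$ (a, b))"
    if M: "\<forall>x\<in>carrier_vec n. M x \<in> sym_mats k" and xy: "x \<in> carrier_vec n" "y \<in> carrier_vec n" for x y t
  proof -
    have "M x \<in> carrier_mat k k" "M y \<in> carrier_mat k k" "M ((1 - t) \<cdot>\<^sub>v x + t \<cdot>\<^sub>v y) \<in> carrier_mat k k"
      using M xy by (auto simp: sym_mats_def)
    then show ?thesis by (auto simp: mat_eq_iff)
  qed
  then show ?thesis unfolding affine_mat_map_def affine_fun_def Pi_iff by (intro conj_cong refl) blast
qed

text \<open>Only two-point combinations are available from the definition. A point with coefficient
  different from 1 is split off and the others are rescaled by the inverse of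
  \<open>1 - y j\<close>; if all coefficients are 1, then \<open>J\<close> is a singleton. The point
  \<open>x\<close> is chosen before \<open>h\<close>.\<close>

lemma affine_combination:
  assumes "finite J" "q ` J \<subseteq> carrier_vec n" "sum y J = (1::real)"
  shows "\<exists>x\<in>carrier_vec n. \<forall>h. affine_fun n h \<longrightarrow> h x = (\<Sum>j\<in>J. y j * h (q j))"
  using assms
proof (induction "card J" arbitrary: J y rule: less_induct)
  case less
  show ?case
  proof (cases "\<exists>j\<in>J. y j \<noteq> 1")
    case True
    then obtain j where j: "j \<in> J" "y j \<noteq> 1" by blast
    let ?J = "J - {j}"
    have s: "sum y ?J = 1 - y j" using less.prems j by (simp add: sum_diff1)
    have "card ?J < card J" using j less.prems(1) by (meson card_Diff1_less)
    moreover have "(\<Sum>i\<in>?J. y i / (1 - y j)) = 1" using s j by (simp flip: sum_divide_distrib)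
    ultimately obtain x where x: "x \<in> carrier_vec n"
      "\<And>h. affine_fun n h \<Longrightarrow> h x = (\<Sum>i\<in>?J. y i / (1 - y j) * h (q i))"
      using less.hyps[of ?J "\<lambda>i. y i / (1 - y j)"] less.prems by blast
    show ?thesis
    proof (intro bexI allI impI)
      have qj: "q j \<in> carrier_vec n" using j less.prems by auto
      then show "(1 - y j) \<cdot>\<^sub>v x + y j \<cdot>\<^sub>v q j \<in> carrier_vec n" using x by auto
      fix h assume h: "affine_fun n h"
      have "h ((1 - y j) \<cdot>\<^sub>v x + y j \<cdot>\<^sub>v q j) = (1 - y j) * h x + y j * h (q j)"
        using h x qj unfolding affine_fun_def by blast
      also have "\<dots> = (\<Sum>i\<in>?J. y i * h (q i)) + y j * h (q j)"
        using j by (simp add: x(2)[OF h] sum_distrib_left)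
      also have "\<dots> = (\<Sum>j\<in>J. y j * h (q j))"
        using less.prems(1) j by (simp add: sum.remove)
      finally show "h ((1 - y j) \<cdot>\<^sub>v x + y j \<cdot>\<^sub>v q j) = (\<Sum>j\<in>J. y j * h (q j))" .
    qed
  next
    case False
    then have "real (card J) = 1" using less.prems by simp
    then obtain j where "J = {j}" by (metis card_1_singletonE of_nat_eq_1_iff)
    then show ?thesis using less.prems by auto
  qed
qed

text \<open>A common form of both notions of formulation: the blocks are kept separate and each is
  affine by itself. One LMI is the case of one block.\<close>

definition block_ef :: "(real ^ 'd) set \<Rightarrow> nat \<Rightarrow> nat \<Rightarrow> bool" where
  "block_ef P l m \<longleftrightarrow> (\<exists>n\<ge>1. \<exists>\<phi> Ms. affine_vec_map n \<phi> \<and> (\<forall>i<l. affine_mat_map n m (Ms i)) \<and>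
     P = \<phi> ` {x \<in> carrier_vec n. \<forall>i<l. Ms i x \<in> psd_mats m})"

lemma block_efI:
  assumes "n \<ge> 1" "affine_vec_map n \<phi>" "\<And>i. i < l \<Longrightarrow> affine_mat_map n m (Ms i)"
    "P = \<phi> ` {x \<in> carrier_vec n. \<forall>i<l. Ms i x \<in> psd_mats m}"
  shows "block_ef P l m"
  using assms unfolding block_ef_def by blast

lemma has_ef_LMI_iff: "has_ef_LMI P k \<longleftrightarrow> block_ef P 1 k"
proof
  assume "has_ef_LMI P k"
  then obtain n \<phi> M where "n \<ge> 1" "extended_formulation n k \<phi> M P" by (auto simp: has_ef_LMI_def)
  then show "block_ef P 1 k" unfolding block_ef_def extended_formulation_def
    by (intro exI[of _ n] exI[of _ \<phi>] exI[of _ "\<lambda>_. M"]) auto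
next
  assume "block_ef P 1 k"
  then show "has_ef_LMI P k" unfolding block_ef_def has_ef_LMI_def extended_formulation_def by auto
qed

section \<open>Block-diagonal matrices with blocks of equal size\<close>

lemma diag_block_mat_equal_blocks:
  assumes "\<And>B. B \<in> set Bs \<Longrightarrow> B \<in> carrier_mat m m"
  shows "diag_block_mat Bs \<in> carrier_mat (length Bs * m) (length Bs * m)"
    and "\<lbrakk>r < length Bs * m; c < length Bs * m\<rbrakk> \<Longrightarrow> diag_block_mat Bs $$ (r, c) =
      (if r div m = c div m then (Bs ! (r div m)) $$ (r mod m, c mod m) else 0)"
proof -
  have "diag_block_mat Bs \<in> carrier_mat (length Bs * m) (length Bs * m) \<and>
    (\<forall>r c. r < length Bs * m \<longrightarrow> c < length Bs * m \<longrightarrow> diag_block_mat Bs $$ (r, c) =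
      (if r div m = c div m then (Bs ! (r div m)) $$ (r mod m, c mod m) else 0))"
    using assms
  proof (induction Bs)
    case (Cons B Bs)
    then have B: "B \<in> carrier_mat m m" and
      D: "diag_block_mat Bs \<in> carrier_mat (length Bs * m) (length Bs * m)" by auto
    have ix: "diag_block_mat (B # Bs) $$ (r, c) = (if r div m = c div m
        then ((B # Bs) ! (r div m)) $$ (r mod m, c mod m) else 0)"
      if rc: "r < m + length Bs * m" "c < m + length Bs * m" for r c
    proof -
      have m: "m > 0" using rc by (cases m) auto
      have dims: "dim_row B = m" "dim_col B = m" using B by auto
      have div: "r div m = (if r < m then 0 else Suc ((r - m) div m))"
        "r mod m = (if r < m then r else (r - m) mod m)" for r
        using m by (auto simp: le_div_geq le_mod_geq)
      show ?thesis
        using rc D Cons.IH Cons.prems dims unfolding div[of r] div[of c]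
        by (auto simp: Let_def index_mat_four_block)
    qed
    show ?case using ix B D by (auto simp: Let_def)
  qed auto
  then show "diag_block_mat Bs \<in> carrier_mat (length Bs * m) (length Bs * m)"
    "\<lbrakk>r < length Bs * m; c < length Bs * m\<rbrakk> \<Longrightarrow> diag_block_mat Bs $$ (r, c) =
      (if r div m = c div m then (Bs ! (r div m)) $$ (r mod m, c mod m) else 0)"
    by blast+
qed

lemma block_index_less: "i < l \<Longrightarrow> a < m \<Longrightarrow> i * m + a < l * (m::nat)"
  using mult_le_mono1[of "Suc i" l m] by simp

lemma sum_blocks: "(\<Sum>r<l * (m::nat). f r) = (\<Sum>i<l. \<Sum>a<m. f (i * m + a))"
proof -
  have "(\<Sum>r<l * m. f r) = (\<Sum>i<l. sum f {i * m..<i * m + m})" by (simp add: sum.nat_group)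
  also have "\<dots> = (\<Sum>i<l. \<Sum>a<m. f (i * m + a))"
  proof (rule sum.cong[OF refl])
    show "sum f {i * m..<i * m + m} = (\<Sum>a<m. f (i * m + a))" for i
      using sum.shift_bounds_nat_ivl[of f 0 "i * m" m] by (simp add: lessThan_atLeast0 add.commute)
  qed
  finally show ?thesis .
qed

text \<open>The form of the block-diagonal matrix is the sum of the forms of the blocks, each
  evaluated at its own segment of the vector.\<close>

lemma
  assumes B: "\<And>i. i < l \<Longrightarrow> B i \<in> sym_mats m"
  defines "D \<equiv> diag_block_mat (map B [0..<l])"
  shows index_diag_blocks: "\<lbrakk>i < l; j < l; a < m; b < m\<rbrakk> \<Longrightarrow>
      D $$ (i * m + a, j * m + b) = (if i = j then B i $$ (a, b) else 0)"
    and diag_blocks_sym: "D \<in> sym_mats (l * m)"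
    and diag_blocks_psd_iff: "D \<in> psd_mats (l * m) \<longleftrightarrow> (\<forall>i<l. B i \<in> psd_mats m)"
proof -
  have Bc: "\<And>A. A \<in> set (map B [0..<l]) \<Longrightarrow> A \<in> carrier_mat m m" using B by (auto simp: sym_mats_def)
  have carr: "D \<in> carrier_mat (l * m) (l * m)"
    using diag_block_mat_equal_blocks(1)[of "map B [0..<l]" m] Bc by (simp add: D_def)
  have ix: "D $$ (r, c) = (if r div m = c div m then (B (r div m)) $$ (r mod m, c mod m) else 0)"
    if "r < l * m" "c < l * m" for r c
    using diag_block_mat_equal_blocks(2)[of "map B [0..<l]" m r c] Bc that by (simp add: D_def less_mult_imp_div_less)
  show ix': "D $$ (i * m + a, j * m + b) = (if i = j then B i $$ (a, b) else 0)"
    if "i < l" "j < l" "a < m" "b < m" for i j a b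
    using ix[OF block_index_less block_index_less] that by auto
  show sym: "D \<in> sym_mats (l * m)"
    unfolding sym_mats_iff
  proof (intro conjI carr allI impI)
    fix r c assume rc: "r < l * m" "c < l * m"
    then have "m > 0" by (cases m) auto
    moreover have "r div m < l" using rc by (simp add: less_mult_imp_div_less)
    ultimately show "D $$ (r, c) = D $$ (c, r)"
      using rc ix B[of "r div m"] by (auto simp: sym_mats_iff)
  qed
  have q: "qform (l * m) (\<lambda>a b. D $$ (a, b)) v = (\<Sum>i<l. qform m (\<lambda>a b. B i $$ (a, b)) (\<lambda>a. v (i * m + a)))" for v
  proof -
    have "(\<Sum>j<l. \<Sum>b<m. v (i * m + a) * D $$ (i * m + a, j * m + b) * v (j * m + b)) =
        (\<Sum>b<m. v (i * m + a) * B i $$ (a, b) * v (i * m + b))" if "i < l" "a < m" for i a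
    proof -
      have "(\<Sum>j<l. \<Sum>b<m. v (i * m + a) * D $$ (i * m + a, j * m + b) * v (j * m + b)) =
        (\<Sum>j<l. if j = i then (\<Sum>b<m. v (i * m + a) * B i $$ (a, b) * v (i * m + b)) else 0)"
        using that by (intro sum.cong refl) (auto simp: ix')
      then show ?thesis using that by simp
    qed
    then show ?thesis unfolding qform_def sum_blocks
      by - (rule sum.cong, rule refl, rule sum.cong, rule refl, simp)
  qed
  show "D \<in> psd_mats (l * m) \<longleftrightarrow> (\<forall>i<l. B i \<in> psd_mats m)"
  proof
    assume "D \<in> psd_mats (l * m)"
    then have nn: "0 \<le> qform (l * m) (\<lambda>a b. D $$ (a, b)) v" for v by (simp add: psd_mats_iff)
    have "0 \<le> qform m (\<lambda>a b. B i $$ (a, b)) w" if i: "i < l" for i w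
    proof -
      \<comment> \<open>The vector \<open>w\<close> placed in block \<open>i\<close> and zero
        elsewhere isolates that block.\<close>
      define v where "v r = (if r div m = i then w (r mod m) else 0)" for r
      have "(\<Sum>j<l. qform m (\<lambda>a b. B j $$ (a, b)) (\<lambda>a. v (j * m + a))) =
        (\<Sum>j<l. if j = i then qform m (\<lambda>a b. B i $$ (a, b)) w else 0)"
        by (intro sum.cong refl) (auto simp: qform_def v_def intro!: sum.cong)
      then show ?thesis using nn[of v] i unfolding q by simp
    qed
    then show "\<forall>i<l. B i \<in> psd_mats m" using B by (auto simp: psd_mats_iff)
  next
    assume "\<forall>i<l. B i \<in> psd_mats m"
    then show "D \<in> psd_mats (l * m)" using sym by (auto simp: psd_mats_iff q intro!: sum_nonneg)
  qed
qed

text \<open>\<open>has_ef_LMIs\<close> requires affinity of the large matrix \<open>M\<close> only.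
  The entries of a block are entries of \<open>M\<close>, and the entries of \<open>M\<close>
  outside the blocks are constantly 0, so the two requirements agree.\<close>

lemma has_ef_LMIs_iff: "has_ef_LMIs P l m \<longleftrightarrow> block_ef P l m"
proof
  assume "has_ef_LMIs P l m"
  then obtain n \<phi> M Ms where n: "n \<ge> 1" and ef: "extended_formulation n (l * m) \<phi> M P"
    and Ms0: "\<forall>i<l. Ms i \<in> carrier_vec n \<rightarrow> sym_mats m"
    and M: "\<forall>x\<in>carrier_vec n. M x = diag_block_mat (map (\<lambda>i. Ms i x) [0..<l])"
    unfolding has_ef_LMIs_def by blast
  have Ms: "\<And>i x. i < l \<Longrightarrow> x \<in> carrier_vec n \<Longrightarrow> Ms i x \<in> sym_mats m" using Ms0 by auto
  have aff: "affine_vec_map n \<phi>" "affine_mat_map n (l * m) M"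
    and P: "P = \<phi> ` {x \<in> carrier_vec n. M x \<in> psd_mats (l * m)}"
    using ef by (auto simp: extended_formulation_def)
  have "affine_mat_map n m (Ms i)" if i: "i < l" for i
    unfolding affine_mat_map_iff
  proof (intro conjI ballI allI impI Ms[OF i])
    fix a b assume ab: "a < m" "b < m"
    have "affine_fun n (\<lambda>x. M x $$ (i * m + a, i * m + b))"
      using aff(2) block_index_less[OF i ab(1)] block_index_less[OF i ab(2)] by (auto simp: affine_mat_map_iff)
    moreover have "M x $$ (i * m + a, i * m + b) = Ms i x $$ (a, b)" if "x \<in> carrier_vec n" for x
      using that Ms i ab by (simp add: M index_diag_blocks)
    ultimately show "affine_fun n (\<lambda>x. Ms i x $$ (a, b))" by (simp add: affine_fun_def)
  qed
  moreover have "{x \<in> carrier_vec n. M x \<in> psd_mats (l * m)} = {x \<in> carrier_vec n. \<forall>i<l. Ms i x \<in> psd_mats m}"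
    using Ms by (auto simp: M diag_blocks_psd_iff)
  ultimately show "block_ef P l m" using n aff P by (intro block_efI[of n \<phi> l m Ms]) auto
next
  assume "block_ef P l m"
  then obtain n \<phi> Ms where n: "n \<ge> 1" and \<phi>: "affine_vec_map n \<phi>"
    and aff: "\<And>i. i < l \<Longrightarrow> affine_mat_map n m (Ms i)"
    and P: "P = \<phi> ` {x \<in> carrier_vec n. \<forall>i<l. Ms i x \<in> psd_mats m}"
    unfolding block_ef_def by blast
  have Ms: "\<And>i x. i < l \<Longrightarrow> x \<in> carrier_vec n \<Longrightarrow> Ms i x \<in> sym_mats m"
    using aff by (auto simp: affine_mat_map_def)
  define M where "M x = diag_block_mat (map (\<lambda>i. Ms i x) [0..<l])" for x
  have Msym: "M x \<in> sym_mats (l * m)" if "x \<in> carrier_vec n" for x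
    unfolding M_def using Ms that by (intro diag_blocks_sym) auto
  have "affine_mat_map n (l * m) M"
    unfolding affine_mat_map_iff
  proof (intro conjI ballI allI impI Msym)
    fix r c assume rc: "r < l * m" "c < l * m"
    define i j a b where "i = r div m" "j = c div m" "a = r mod m" "b = c mod m"
    have m: "m > 0" using rc by (cases m) auto
    have ij: "i < l" "j < l" "a < m" "b < m" "r = i * m + a" "c = j * m + b"
      using rc m by (auto simp: i_j_a_b_def less_mult_imp_div_less)
    have Mx: "M x $$ (r, c) = (if i = j then Ms i x $$ (a, b) else 0)" if "x \<in> carrier_vec n" for x
      unfolding M_def ij(5,6) using that Ms by (intro index_diag_blocks ij) auto
    have "affine_fun n (\<lambda>x. Ms i x $$ (a, b))"
      using aff[OF ij(1)] ij by (auto simp: affine_mat_map_iff)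
    then show "affine_fun n (\<lambda>x. M x $$ (r, c))"
      by (cases "i = j") (simp_all add: affine_fun_def Mx)
  qed
  moreover have "{x \<in> carrier_vec n. M x \<in> psd_mats (l * m)} = {x \<in> carrier_vec n. \<forall>i<l. Ms i x \<in> psd_mats m}"
    unfolding M_def using Ms by (auto simp: diag_blocks_psd_iff)
  ultimately show "has_ef_LMIs P l m"
    unfolding has_ef_LMIs_def extended_formulation_def using n \<phi> P Ms
    by (intro exI[of _ n] exI[of _ \<phi>] exI[of _ M] exI[of _ Ms] conjI) (auto simp: M_def)
qed

lemma has_ef_LMIs_imp_has_ef_LMI: "has_ef_LMIs P l m \<Longrightarrow> has_ef_LMI P (l * m)"
  unfolding has_ef_LMIs_def has_ef_LMI_def by blast

section \<open>Padding of formulations, and linear formulations of polytopes\<close>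

text \<open>The added blocks are zero and hence always feasible. This brings a family to the common
  number of inequalities given by its maximal \<open>xc\<close>.\<close>

lemma block_ef_mono_number:
  assumes "block_ef P l m" "l \<le> l'"
  shows "block_ef P l' m"
proof -
  obtain n \<phi> Ms where ef: "n \<ge> 1" "affine_vec_map n \<phi>"
    "\<And>i. i < l \<Longrightarrow> affine_mat_map n m (Ms i)"
    "P = \<phi> ` {x \<in> carrier_vec n. \<forall>i<l. Ms i x \<in> psd_mats m}"
    using assms(1) unfolding block_ef_def by blast
  define Ms' where "Ms' i = (if i < l then Ms i else (\<lambda>_. 0\<^sub>m m m))" for i
  have "affine_mat_map n m (Ms' i)" for i
    using ef(3) by (auto simp: Ms'_def affine_mat_map_iff affine_fun_def sym_mats_iff)
  moreover have "0\<^sub>m m m \<in> psd_mats m" by (simp add: psd_mats_iff sym_mats_iff qform_def)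
  then have "(\<forall>i<l'. Ms' i x \<in> psd_mats m) \<longleftrightarrow> (\<forall>i<l. Ms i x \<in> psd_mats m)" for x
    using assms(2) by (auto simp: Ms'_def)
  ultimately show ?thesis using ef by (intro block_efI[of n \<phi> l' m Ms']) auto
qed

lemma qform_zero_padding:
  assumes "m \<le> m'"
  shows "qform m' (\<lambda>a b. if a < m \<and> b < m then A a b else 0) v = qform m A v"
proof -
  have "(\<Sum>b<m'. v a * (if a < m \<and> b < m then A a b else 0) * v b) =
    (if a < m then (\<Sum>b<m. v a * A a b * v b) else 0)" for a
  proof (cases "a < m")
    case True
    have "(\<Sum>b<m'. v a * (if a < m \<and> b < m then A a b else 0) * v b) =
      (\<Sum>b<m. v a * (if a < m \<and> b < m then A a b else 0) * v b)"
      using assms by (intro sum.mono_neutral_right) auto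
    then show ?thesis using True by simp
  qed simp
  then have "qform m' (\<lambda>a b. if a < m \<and> b < m then A a b else 0) v =
    (\<Sum>a<m'. if a < m then (\<Sum>b<m. v a * A a b * v b) else 0)" by (simp add: qform_def)
  also have "\<dots> = (\<Sum>a<m. if a < m then (\<Sum>b<m. v a * A a b * v b) else 0)"
    using assms by (intro sum.mono_neutral_right) auto
  finally show ?thesis by (simp add: qform_def)
qed

text \<open>Each block is extended by zero rows and columns, which leave its form unchanged. This
  brings a family to the common size given by its maximal \<open>sxc\<close>.\<close>

lemma block_ef_mono_size:
  assumes "block_ef P l m" "m \<le> m'"
  shows "block_ef P l m'"
proof -
  obtain n \<phi> Ms where ef: "n \<ge> 1" "affine_vec_map n \<phi>"
    "\<And>i. i < l \<Longrightarrow> affine_mat_map n m (Ms i)"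
    "P = \<phi> ` {x \<in> carrier_vec n. \<forall>i<l. Ms i x \<in> psd_mats m}"
    using assms(1) unfolding block_ef_def by blast
  define Ms' where "Ms' i x = mat m' m' (\<lambda>(a, b). if a < m \<and> b < m then Ms i x $$ (a, b) else 0)" for i x
  have q: "qform m' (\<lambda>a b. Ms' i x $$ (a, b)) v = qform m (\<lambda>a b. Ms i x $$ (a, b)) v" for i x v
  proof -
    have "qform m' (\<lambda>a b. Ms' i x $$ (a, b)) v =
      qform m' (\<lambda>a b. if a < m \<and> b < m then Ms i x $$ (a, b) else 0) v"
      unfolding qform_def by (intro sum.cong refl) (auto simp: Ms'_def)
    then show ?thesis using qform_zero_padding[OF assms(2)] by simp
  qed
  have sym: "Ms i x \<in> sym_mats m" "Ms' i x \<in> sym_mats m'" if "i < l" "x \<in> carrier_vec n" for i x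
    using ef(3)[OF that(1)] that by (auto simp: Ms'_def affine_mat_map_iff sym_mats_iff)
  have "affine_mat_map n m' (Ms' i)" if "i < l" for i
    using ef(3)[OF that] that sym by (auto simp: affine_mat_map_iff) (auto simp: affine_fun_def Ms'_def)
  moreover have "{x \<in> carrier_vec n. \<forall>i<l. Ms' i x \<in> psd_mats m'} = {x \<in> carrier_vec n. \<forall>i<l. Ms i x \<in> psd_mats m}"
    using sym by (auto simp: psd_mats_iff q)
  ultimately show ?thesis using ef by (intro block_efI[of n \<phi> l m' Ms']) auto
qed

text \<open>The variables are the coefficients of convex combinations of a finite set that spans
  \<open>P\<close>. It ensures that the minimum in \<open>xc\<close> is attained.\<close>

lemma polytope_has_linear_ef:
  assumes "polytope P" "P \<noteq> {}"
  shows "\<exists>l\<ge>1. block_ef P l 1"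
proof -
  obtain V where V: "finite V" "P = convex hull V" using assms(1) by (auto simp: polytope_def)
  define n where "n = card V"
  have n: "n \<ge> 1" using V assms(2) by (auto simp: n_def Suc_le_eq card_gt_0_iff)
  obtain g where g: "bij_betw g {..<n} V"
    using ex_bij_betw_nat_finite[OF V(1)] by (metis lessThan_atLeast0 n_def)
  define s where "s x = (\<Sum>j<n. vec_index x j)" for x :: "real Matrix.vec"
  \<comment> \<open>Indices below \<open>n\<close> state nonnegativity; the indices \<open>n\<close>
    and \<open>n + 1\<close> together state that the coefficients sum to one.\<close>
  define Ms where "Ms i x = mat 1 1 (\<lambda>_. if i < n then vec_index x i else if i = n then s x - 1 else 1 - s x)"
    for i and x :: "real Matrix.vec"
  define \<phi> where "\<phi> x = (\<Sum>j<n. vec_index x j *\<^sub>R g j)" for x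
  have psd1: "A \<in> psd_mats 1 \<longleftrightarrow> A \<in> carrier_mat 1 1 \<and> 0 \<le> A $$ (0, 0)" for A :: "real mat"
  proof -
    have "0 \<le> v * a * v" if "0 \<le> a" for v a :: real
      using that by (metis mult.commute mult.left_commute mult_nonneg_nonneg zero_le_square)
    then show ?thesis
      by (auto simp: psd_mats_iff sym_mats_iff qform_def dest: spec[of _ "\<lambda>_. 1"])
  qed
  have aff_ix: "affine_fun n (\<lambda>x. vec_index x j)" if "j < n" for j
    using that by (auto simp: affine_fun_def)
  have aff_sum: "affine_fun n (\<lambda>x. \<Sum>j<n. vec_index x j * c j)" for c
  proof -
    have "(\<Sum>j<n. vec_index ((1 - t) \<cdot>\<^sub>v x + t \<cdot>\<^sub>v y) j * c j) =
        (\<Sum>j<n. (1 - t) * (vec_index x j * c j) + t * (vec_index y j * c j))"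
      if "x \<in> carrier_vec n" "y \<in> carrier_vec n" for x y t
      using that by (intro sum.cong refl) (auto simp: algebra_simps)
    then show ?thesis unfolding affine_fun_def by (auto simp: sum.distrib sum_distrib_left)
  qed
  have "affine_fun n s" unfolding s_def using aff_sum[of "\<lambda>_. 1"] by simp
  then have "affine_fun n (\<lambda>x. s x - 1)" "affine_fun n (\<lambda>x. 1 - s x)"
    unfolding affine_fun_def by (simp_all add: algebra_simps)
  then have "affine_mat_map n 1 (Ms i)" for i
    using aff_ix[of i] by (cases "i < n"; cases "i = n") (auto simp: affine_mat_map_iff Ms_def sym_mats_iff)
  moreover have "affine_vec_map n \<phi>"
    unfolding affine_vec_map_iff \<phi>_def using aff_sum by simp
  moreover have "P = \<phi> ` {x \<in> carrier_vec n. \<forall>i<n + 2. Ms i x \<in> psd_mats 1}"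
  proof -
    have psd_Ms: "Ms i x \<in> psd_mats 1 \<longleftrightarrow>
      0 \<le> (if i < n then vec_index x i else if i = n then s x - 1 else 1 - s x)" for i x
      unfolding psd1 by (simp add: Ms_def)
    have feas: "(\<forall>i<n + 2. Ms i x \<in> psd_mats 1) \<longleftrightarrow> (\<forall>j<n. 0 \<le> vec_index x j) \<and> s x = 1" for x
    proof
      assume *: "\<forall>i<n + 2. Ms i x \<in> psd_mats 1"
      have "0 \<le> vec_index x j" if "j < n" for j
        using *[rule_format, of j] that unfolding psd_Ms by simp
      then show "(\<forall>j<n. 0 \<le> vec_index x j) \<and> s x = 1"
        using *[rule_format, of n] *[rule_format, of "Suc n"] unfolding psd_Ms by simp
    qed (simp add: psd_Ms del: One_nat_def)
    have "p \<in> \<phi> ` {x \<in> carrier_vec n. (\<forall>j<n. 0 \<le> vec_index x j) \<and> s x = 1}" if "p \<in> P" for p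
    proof -
      obtain u where u: "\<forall>v\<in>V. 0 \<le> u v" "sum u V = 1" "(\<Sum>v\<in>V. u v *\<^sub>R v) = p"
        using \<open>p \<in> P\<close> unfolding V(2) convex_hull_finite[OF V(1)] by blast
      define x where "x = Matrix.vec n (\<lambda>j. u (g j))"
      have "s x = sum u V" using sum.reindex_bij_betw[OF g, of u] by (simp add: s_def x_def)
      moreover have "\<phi> x = p" using sum.reindex_bij_betw[OF g, of "\<lambda>v. u v *\<^sub>R v"] u by (simp add: \<phi>_def x_def)
      moreover have "\<forall>j<n. 0 \<le> vec_index x j" using u(1) bij_betwE[OF g] by (auto simp: x_def)
      ultimately show ?thesis using u(2) by (intro image_eqI[of _ _ x]) (auto simp: x_def)
    qed
    moreover have "\<phi> x \<in> P" if "x \<in> carrier_vec n" "\<forall>j<n. 0 \<le> vec_index x j" "s x = 1" for x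
      unfolding \<phi>_def
    proof (rule convex_sum)
      show "convex P" using V by simp
      show "g j \<in> P" if "j \<in> {..<n}" for j
        using bij_betwE[OF g] that V by (auto intro: hull_inc)
    qed (use that in \<open>auto simp: s_def\<close>)
    ultimately show ?thesis unfolding feas by blast
  qed
  ultimately have "block_ef P (n + 2) 1" using n by (intro block_efI[of n \<phi> "n + 2" 1 Ms]) auto
  then show ?thesis by (intro exI[of _ "n + 2"]) simp
qed

section \<open>Normalized formulations\<close>

lemma qform_sum:
  "qform m (\<lambda>a b. \<Sum>j\<in>J. y j * F j a b) w = (\<Sum>j\<in>J. y j * qform m (F j) w)"
proof -
  have "qform m (\<lambda>a b. \<Sum>j\<in>J. y j * F j a b) w = (\<Sum>a<m. \<Sum>b<m. \<Sum>j\<in>J. y j * (w a * F j a b * w b))"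
    unfolding qform_def by (simp add: sum_distrib_left sum_distrib_right mult_ac)
  also have "\<dots> = (\<Sum>a<m. \<Sum>j\<in>J. \<Sum>b<m. y j * (w a * F j a b * w b))"
    by (intro sum.cong refl sum.swap)
  also have "\<dots> = (\<Sum>j\<in>J. \<Sum>a<m. \<Sum>b<m. y j * (w a * F j a b * w b))" by (rule sum.swap)
  finally show ?thesis by (simp add: qform_def sum_distrib_left)
qed

lemma qform_square: "qform m (\<lambda>a b. c a * c b) w = (\<Sum>a<m. w a * c a)\<^sup>2"
  unfolding qform_def power2_eq_square sum_product by (intro sum.cong refl) (simp add: mult_ac)

text \<open>With the vectors \<open>E p\<close> as the rows of a matrix E, the left side is the form
  of the congruent matrix E^T F E, which is \<open>F\<close> evaluated at E w.\<close>

lemma qform_congruence: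
  "qform m (\<lambda>a b. \<Sum>p<m. \<Sum>q<m. E p a * F p q * E q b) w = qform m F (\<lambda>p. \<Sum>a<m. w a * E p a)"
proof -
  have "qform m (\<lambda>a b. \<Sum>p<m. \<Sum>q<m. E p a * F p q * E q b) w =
      (\<Sum>a<m. \<Sum>b<m. \<Sum>p<m. \<Sum>q<m. (w a * E p a) * F p q * (w b * E q b))"
    unfolding qform_def by (simp add: sum_distrib_left sum_distrib_right mult_ac)
  also have "\<dots> = (\<Sum>a<m. \<Sum>p<m. \<Sum>b<m. \<Sum>q<m. (w a * E p a) * F p q * (w b * E q b))"
    by (intro sum.cong refl sum.swap)
  also have "\<dots> = (\<Sum>p<m. \<Sum>a<m. \<Sum>b<m. \<Sum>q<m. (w a * E p a) * F p q * (w b * E q b))"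
    by (rule sum.swap)
  also have "\<dots> = (\<Sum>p<m. \<Sum>a<m. \<Sum>q<m. \<Sum>b<m. (w a * E p a) * F p q * (w b * E q b))"
    by (intro sum.cong refl sum.swap)
  also have "\<dots> = (\<Sum>p<m. \<Sum>q<m. \<Sum>a<m. \<Sum>b<m. (w a * E p a) * F p q * (w b * E q b))"
    by (intro sum.cong refl sum.swap)
  finally show ?thesis by (simp add: qform_def sum_distrib_left sum_distrib_right mult_ac)
qed

text \<open>Each \<open>A v\<close> is a sum of \<open>m\<close> squares of vectors; a spanner of
  all these vectors gives the rows of \<open>E\<close>. Coefficients of size at most 1 bound the
  entries of \<open>F\<close> by \<open>m\<close>. If the spanning vector \<open>p\<close> occurs in
  the squares of \<open>A (s p)\<close>, then in the new coordinates it is a unit vector, so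
  \<open>F (s p)\<close> dominates the square of coordinate \<open>p\<close>.\<close>

lemma psd_family_coordinates:
  fixes A :: "'v \<Rightarrow> nat \<Rightarrow> nat \<Rightarrow> real"
  assumes V: "finite V" "V \<noteq> {}"
    and sym: "\<And>v a b. \<lbrakk>v \<in> V; a < m; b < m\<rbrakk> \<Longrightarrow> A v a b = A v b a"
    and psd: "\<And>v w. v \<in> V \<Longrightarrow> 0 \<le> qform m (A v) w"
  shows "\<exists>E F s. (\<forall>p<m. s p \<in> V) \<and>
    (\<forall>v\<in>V. \<forall>a<m. \<forall>b<m. A v a b = (\<Sum>p<m. \<Sum>q<m. E p a * F v p q * E q b)) \<and>
    (\<forall>v\<in>V. \<forall>p<m. \<forall>q<m. \<bar>F v p q\<bar> \<le> real m) \<and>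
    (\<forall>v\<in>V. \<forall>w. 0 \<le> qform m (F v) w) \<and>
    (\<forall>p<m. \<forall>w. (w p)\<^sup>2 \<le> qform m (F (s p)) w)"
proof -
  have "\<forall>v\<in>V. \<exists>c. \<forall>a<m. \<forall>b<m. A v a b = (\<Sum>j<m. c j a * c j b)"
    using psd_sum_of_squares[of m] sym psd by blast
  then obtain c where c: "\<And>v a b. \<lbrakk>v \<in> V; a < m; b < m\<rbrakk> \<Longrightarrow> A v a b = (\<Sum>j<m. c v j a * c v j b)"
    unfolding bchoice_iff by blast
  have fin: "finite (V \<times> {..<m})" using V(1) by simp
  obtain n e coef where n_card: "n \<le> card {..<m}" and e: "e ` {..<n} \<subseteq> V \<times> {..<m}"
    and expand: "\<And>i a. i \<in> V \<times> {..<m} \<Longrightarrow> a \<in> {..<m} \<Longrightarrow>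
      c (fst i) (snd i) a = (\<Sum>p<n. coef i p * c (fst (e p)) (snd (e p)) a)"
    and bnd: "\<And>i p. i \<in> V \<times> {..<m} \<Longrightarrow> p < n \<Longrightarrow> \<bar>coef i p\<bar> \<le> 1"
    and unit: "\<And>p q. p < n \<Longrightarrow> q < n \<Longrightarrow> coef (e p) q = (if p = q then 1 else 0)"
    by (rule barycentric_spanner[OF fin finite_lessThan, of m "\<lambda>i a. c (fst i) (snd i) a"]) (rule that)
  have n: "n \<le> m" using n_card by simp
  obtain v0 where v0: "v0 \<in> V" using V(2) by blast
  define cc where "cc v j p = (if p < n then coef (v, j) p else 0)" for v j p
  txt \<open>
    The summand \<open>D\<close> is the identity on the coordinates \<open>p \<ge> n\<close>, where \<open>E p\<close> vanishes: it does not
    change the represented matrices but makes their average positive definite.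
  \<close>
  define D where "D p q = (if p = q \<and> n \<le> p then 1 else 0 :: real)" for p q
  define F where "F v p q = (\<Sum>j<m. 1 * (cc v j p * cc v j q)) + D p q" for v p q
  define E where "E p a = (if p < n then c (fst (e p)) (snd (e p)) a else 0)" for p a
  \<comment> \<open>For \<open>p\<close> from \<open>n\<close> on any member serves, because the
    summand \<open>D\<close> already dominates that coordinate.\<close>
  define s where "s p = (if p < n then fst (e p) else v0)" for p
  have e_mem: "fst (e p) \<in> V" "snd (e p) < m" if "p < n" for p
    using e that by (auto simp: image_subset_iff mem_Times_iff)
  have qD: "qform m D w = (\<Sum>p<m. if n \<le> p then (w p)\<^sup>2 else 0)" for w
  proof -
    have "(\<Sum>q<m. w p * D p q * w q) = (if n \<le> p then (w p)\<^sup>2 else 0)" if "p < m" for p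
    proof -
      have "(\<Sum>q<m. w p * D p q * w q) = (\<Sum>q<m. if q = p then (if n \<le> p then (w p)\<^sup>2 else 0) else 0)"
        by (intro sum.cong refl) (auto simp: D_def power2_eq_square)
      then show ?thesis using that by simp
    qed
    then show ?thesis by (simp add: qform_def)
  qed
  have qF: "qform m (F v) w = (\<Sum>j<m. (\<Sum>p<m. w p * cc v j p)\<^sup>2) + (\<Sum>p<m. if n \<le> p then (w p)\<^sup>2 else 0)" for v w
  proof -
    have "qform m (F v) w = qform m (\<lambda>p q. \<Sum>j<m. 1 * (cc v j p * cc v j q)) w + qform m D w"
      unfolding qform_def F_def by (simp add: algebra_simps sum.distrib)
    then show ?thesis unfolding qform_sum qform_square qD by simp
  qed
  have "s p \<in> V" for p using e_mem v0 by (simp add: s_def)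
  moreover have "A v a b = (\<Sum>p<m. \<Sum>q<m. E p a * F v p q * E q b)"
    if v: "v \<in> V" and ab: "a < m" "b < m" for v a b
  proof -
    have ce: "c v j a = (\<Sum>p<m. cc v j p * E p a)" if "j < m" "a < m" for j a
    proof -
      have "(\<Sum>p<m. cc v j p * E p a) = (\<Sum>p<n. cc v j p * E p a)"
        using n by (intro sum.mono_neutral_right) (auto simp: cc_def)
      then show ?thesis using expand[of "(v, j)" a] v that by (simp add: cc_def E_def)
    qed
    have "A v a b = (\<Sum>j<m. (\<Sum>p<m. cc v j p * E p a) * (\<Sum>q<m. cc v j q * E q b))"
      using c[OF v ab] ce ab by simp
    also have "\<dots> = (\<Sum>j<m. \<Sum>p<m. \<Sum>q<m. E p a * (cc v j p * cc v j q) * E q b)"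
      by (simp add: sum_product mult_ac)
    also have "\<dots> = (\<Sum>p<m. \<Sum>j<m. \<Sum>q<m. E p a * (cc v j p * cc v j q) * E q b)"
      by (rule sum.swap)
    also have "\<dots> = (\<Sum>p<m. \<Sum>q<m. \<Sum>j<m. E p a * (cc v j p * cc v j q) * E q b)"
      by (intro sum.cong refl sum.swap)
    also have "\<dots> = (\<Sum>p<m. \<Sum>q<m. E p a * F v p q * E q b)"
    proof (intro sum.cong refl)
      fix p q
      have "E p a * D p q * E q b = 0" by (simp add: D_def E_def)
      then show "(\<Sum>j<m. E p a * (cc v j p * cc v j q) * E q b) = E p a * F v p q * E q b"
        by (simp add: F_def algebra_simps sum_distrib_left sum_distrib_right)
    qed
    finally show ?thesis .
  qed
  moreover have "\<bar>F v p q\<bar> \<le> real m" if v: "v \<in> V" and pq: "p < m" "q < m" for v p q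
  proof (cases "p < n \<and> q < n")
    case True
    have "\<bar>F v p q\<bar> \<le> (\<Sum>j<m. \<bar>cc v j p * cc v j q\<bar>)"
      using True by (simp add: F_def D_def sum_abs)
    also have "\<dots> \<le> (\<Sum>j<m. 1)"
    proof (intro sum_mono)
      fix j assume "j \<in> {..<m}"
      then have "\<bar>cc v j p\<bar> \<le> 1" "\<bar>cc v j q\<bar> \<le> 1" using bnd[of "(v, j)"] v True by (auto simp: cc_def)
      then show "\<bar>cc v j p * cc v j q\<bar> \<le> 1" by (simp add: abs_mult mult_le_one)
    qed
    finally show ?thesis by simp
  next
    case False
    then have "(\<Sum>j<m. 1 * (cc v j p * cc v j q)) = 0" by (intro sum.neutral) (auto simp: cc_def)
    then have "\<bar>F v p q\<bar> \<le> 1" by (simp add: F_def D_def)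
    then show ?thesis using pq by linarith
  qed
  moreover have "0 \<le> qform m (F v) w" for v w
    unfolding qF by (intro add_nonneg_nonneg sum_nonneg) auto
  moreover have "(w p)\<^sup>2 \<le> qform m (F (s p)) w" if p: "p < m" for p w
  proof (cases "p < n")
    case True
    let ?v = "fst (e p)" and ?j = "snd (e p)"
    have "(\<Sum>q<m. w q * cc ?v ?j q) = (\<Sum>q<m. if q = p then w p else 0)"
      using True unit[OF True] by (intro sum.cong refl) (auto simp: cc_def)
    then have "(w p)\<^sup>2 = (\<Sum>q<m. w q * cc ?v ?j q)\<^sup>2" using p by simp
    also have "\<dots> \<le> (\<Sum>j<m. (\<Sum>q<m. w q * cc ?v j q)\<^sup>2)"
      using e_mem[OF True] by (intro member_le_sum) auto
    also have "\<dots> \<le> qform m (F ?v) w" unfolding qF by (simp add: sum_nonneg)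
    finally show ?thesis using True by (simp add: s_def)
  next
    case False
    then have "(w p)\<^sup>2 = (if n \<le> p then (w p)\<^sup>2 else 0)" by simp
    also have "\<dots> \<le> (\<Sum>p<m. if n \<le> p then (w p)\<^sup>2 else 0)" using p by (intro member_le_sum) auto
    also have "\<dots> \<le> qform m (F (s p)) w" unfolding qF by (simp add: sum_nonneg)
    finally show ?thesis .
  qed
  ultimately show ?thesis by (intro exI[of _ E] exI[of _ F] exI[of _ s]) blast
qed

section \<open>The normal form and its existence\<close>

text \<open>There is no constant term: it is absorbed by the condition that the coefficients
  \<open>y\<close> sum to one.\<close>

definition pencil :: "nat \<Rightarrow> (nat \<Rightarrow> nat \<Rightarrow> nat \<Rightarrow> nat \<Rightarrow> real) \<Rightarrow> (nat \<Rightarrow> real) \<Rightarrow> nat \<Rightarrow> nat \<Rightarrow> nat \<Rightarrow> real" where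
  "pencil N F y i a b = (\<Sum>j<N. y j * F j i a b)"

text \<open>The pair of \<open>t\<close> and \<open>F\<close> is the parameter vector that encodes
  \<open>P\<close>. The third clause is soundness, the fourth completeness with bounded
  coefficients, so that perturbed data have a bounded effect. The last clause is a strictly feasible
  center whose slack absorbs perturbation errors.\<close>

definition normalized_ef ::
  "(real ^ 'd) set \<Rightarrow> nat \<Rightarrow> nat \<Rightarrow> nat \<Rightarrow> (nat \<Rightarrow> real ^ 'd) \<Rightarrow> (nat \<Rightarrow> nat \<Rightarrow> nat \<Rightarrow> nat \<Rightarrow> real) \<Rightarrow> bool"
  where
  "normalized_ef P l m N t F \<longleftrightarrow>
    (\<forall>j<N. t j \<in> P) \<and>
    (\<forall>j<N. \<forall>i<l. \<forall>a<m. \<forall>b<m. \<bar>F j i a b\<bar> \<le> real m) \<and>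
    (\<forall>y. sum y {..<N} = 1 \<longrightarrow> (\<forall>i<l. \<forall>w. 0 \<le> qform m (pencil N F y i) w) \<longrightarrow> (\<Sum>j<N. y j *\<^sub>R t j) \<in> P) \<and>
    (\<forall>p\<in>P. \<exists>y. sum y {..<N} = 1 \<and> (\<forall>j<N. \<bar>y j\<bar> \<le> 1) \<and>
      (\<forall>i<l. \<forall>w. 0 \<le> qform m (pencil N F y i) w) \<and> p = (\<Sum>j<N. y j *\<^sub>R t j)) \<and>
    (\<exists>y. sum y {..<N} = 1 \<and> (\<forall>j<N. \<bar>y j\<bar> \<le> 1) \<and>
      (\<forall>i<l. \<forall>w. (\<Sum>a<m. (w a)\<^sup>2) / (real l * real m) \<le> qform m (pencil N F y i) w))"

lemma
  assumes "normalized_ef P l m N t F"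
  shows normalized_ef_mem: "j < N \<Longrightarrow> t j \<in> P"
    and normalized_ef_bound: "\<lbrakk>j < N; i < l; a < m; b < m\<rbrakk> \<Longrightarrow> \<bar>F j i a b\<bar> \<le> real m"
    and normalized_ef_sound: "\<lbrakk>sum y {..<N} = 1; \<And>i w. i < l \<Longrightarrow> 0 \<le> qform m (pencil N F y i) w\<rbrakk> \<Longrightarrow>
      (\<Sum>j<N. y j *\<^sub>R t j) \<in> P"
    and normalized_ef_complete: "p \<in> P \<Longrightarrow> \<exists>y. sum y {..<N} = 1 \<and> (\<forall>j<N. \<bar>y j\<bar> \<le> 1) \<and>
      (\<forall>i<l. \<forall>w. 0 \<le> qform m (pencil N F y i) w) \<and> p = (\<Sum>j<N. y j *\<^sub>R t j)"
    and normalized_ef_center: "\<exists>y. sum y {..<N} = 1 \<and> (\<forall>j<N. \<bar>y j\<bar> \<le> 1) \<and>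
      (\<forall>i<l. \<forall>w. (\<Sum>a<m. (w a)\<^sup>2) / (real l * real m) \<le> qform m (pencil N F y i) w)"
  using assms unfolding normalized_ef_def by simp_all

text \<open>Passes from coefficient vectors of spanning points to those of arbitrary points of the
  hull and of averages, by an exchange of summations.\<close>

lemma convex_combination_rows:
  fixes u :: "'x \<Rightarrow> real" and y :: "'x \<Rightarrow> nat \<Rightarrow> real"
  assumes u: "\<And>x. x \<in> X \<Longrightarrow> 0 \<le> u x" "sum u X = 1"
    and y: "\<And>x. x \<in> X \<Longrightarrow> sum (y x) {..<N} = 1" "\<And>x j. x \<in> X \<Longrightarrow> j < N \<Longrightarrow> \<bar>y x j\<bar> \<le> 1"
  defines "Y \<equiv> \<lambda>j. \<Sum>x\<in>X. u x * y x j"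
  shows "sum Y {..<N} = 1" and "j < N \<Longrightarrow> \<bar>Y j\<bar> \<le> 1"
    and "(\<Sum>j<N. Y j *\<^sub>R T j) = (\<Sum>x\<in>X. u x *\<^sub>R (\<Sum>j<N. y x j *\<^sub>R (T j :: 'z :: real_vector)))"
proof -
  \<comment> \<open>Polymorphic in the target of \<open>T\<close>, so that the constant 1 yields the
    claim on the sum of \<open>Y\<close>.\<close>
  have swap: "(\<Sum>j<N. Y j *\<^sub>R T j) = (\<Sum>x\<in>X. u x *\<^sub>R (\<Sum>j<N. y x j *\<^sub>R T j))"
    for T :: "nat \<Rightarrow> 'y :: real_vector"
    unfolding Y_def scaleR_sum_left scaleR_sum_right
    by (subst sum.swap) simp
  show "(\<Sum>j<N. Y j *\<^sub>R T j) = (\<Sum>x\<in>X. u x *\<^sub>R (\<Sum>j<N. y x j *\<^sub>R T j))" by (rule swap)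
  show "sum Y {..<N} = 1" using swap[of "\<lambda>_. 1 :: real"] u y by simp
  assume j: "j < N"
  have "\<bar>Y j\<bar> \<le> (\<Sum>x\<in>X. \<bar>u x * y x j\<bar>)" unfolding Y_def by (rule sum_abs)
  also have "\<dots> \<le> (\<Sum>x\<in>X. u x)"
    using u y j by (intro sum_mono) (auto simp: abs_mult mult_left_le)
  finally show "\<bar>Y j\<bar> \<le> 1" using u by simp
qed

text \<open>A nonconstant ray leaves every ball. It turns boundedness of \<open>P\<close> into
  statements about lifted points whose fibers may be unbounded.\<close>

lemma bounded_ray_trivial:
  fixes a b :: "'a :: real_normed_vector"
  assumes "bounded P" "\<And>t. t \<ge> 0 \<Longrightarrow> (1 - t) *\<^sub>R a + t *\<^sub>R b \<in> P"
  shows "a = b"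
proof (rule ccontr)
  assume "a \<noteq> b"
  obtain C where C: "\<And>x. x \<in> P \<Longrightarrow> norm x \<le> C" using assms(1) by (auto simp: bounded_iff)
  have "norm a \<le> C" using C[OF assms(2)[of 0]] by simp
  then have C0: "0 \<le> C" using norm_ge_zero order_trans by blast
  \<comment> \<open>Makes the displacement from \<open>a\<close> equal to \<open>2 * C + 1\<close>,
    while two points of \<open>P\<close> are at most \<open>2 * C\<close> apart.\<close>
  define t where "t = (2 * C + 1) / norm (b - a)"
  have t: "t \<ge> 0" using C0 by (simp add: t_def)
  have "(1 - t) *\<^sub>R a + t *\<^sub>R b = a + t *\<^sub>R (b - a)" by (simp add: algebra_simps)
  then have "norm (a + t *\<^sub>R (b - a)) \<le> C" using C[OF assms(2)[OF t]] by simp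
  then have "norm (t *\<^sub>R (b - a)) \<le> C + norm a"
    using norm_triangle_ineq4[of "a + t *\<^sub>R (b - a)" a] by simp
  moreover have "norm (t *\<^sub>R (b - a)) = 2 * C + 1" using \<open>a \<noteq> b\<close> C0 by (simp add: t_def)
  ultimately show False using \<open>norm a \<le> C\<close> by simp
qed

text \<open>Two spanners in succession: \<open>psd_family_coordinates\<close> normalizes each block
  separately, then one spanner over the entries of all blocks selects the points \<open>t j\<close>.
  Boundedness and dimension at least one make the linear dependences found by the second spanner
  affine ones.\<close>

lemma normalized_ef_exists:
  fixes P :: "(real ^ 'd) set"
  assumes poly: "polytope P" and dim: "1 \<le> aff_dim P" and ef: "block_ef P l m"
    and lm: "1 \<le> l" "1 \<le> m"
  shows "\<exists>t F. normalized_ef P l m (l * m * m) t F"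
proof -
  define N where "N = l * m * m"
  obtain V where V: "finite V" "P = convex hull V" using poly by (auto simp: polytope_def)
  have V_ne: "V \<noteq> {}" using dim V by auto
  have VP: "V \<subseteq> P" using V by (simp add: hull_subset)
  have bdd: "bounded P" using poly by (rule polytope_imp_bounded)
  obtain n \<phi> Ms where \<phi>: "affine_vec_map n \<phi>" and aff: "\<And>i. i < l \<Longrightarrow> affine_mat_map n m (Ms i)"
    and P: "P = \<phi> ` {x \<in> carrier_vec n. \<forall>i<l. Ms i x \<in> psd_mats m}"
    using ef unfolding block_ef_def by blast
  have Ms_sym: "Ms i x \<in> sym_mats m" if "i < l" "x \<in> carrier_vec n" for i x
    using aff that by (auto simp: affine_mat_map_iff)
  have \<phi>_mem: "\<phi> x \<in> P" if "x \<in> carrier_vec n" "\<And>i w. i < l \<Longrightarrow> 0 \<le> qform m (\<lambda>a b. Ms i x $$ (a, b)) w" for x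
    unfolding P using that Ms_sym by (auto simp: psd_mats_iff)
  have "\<forall>v\<in>V. \<exists>x. x \<in> carrier_vec n \<and> \<phi> x = v \<and> (\<forall>i<l. Ms i x \<in> psd_mats m)"
    using VP unfolding P by auto
  then obtain q where q: "\<And>v. v \<in> V \<Longrightarrow> q v \<in> carrier_vec n" "\<And>v. v \<in> V \<Longrightarrow> \<phi> (q v) = v"
    "\<And>v i. v \<in> V \<Longrightarrow> i < l \<Longrightarrow> Ms i (q v) \<in> psd_mats m"
    unfolding bchoice_iff by auto
  define A where "A i v a b = Ms i (q v) $$ (a, b)" for i v a b
  \<comment> \<open>The coefficients may be negative, so \<open>x\<close> need not be
    feasible.\<close>
  have comb: "\<exists>x\<in>carrier_vec n. \<phi> x = (\<Sum>j\<in>J. y j *\<^sub>R g j) \<and>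
      (\<forall>i<l. \<forall>a<m. \<forall>b<m. Ms i x $$ (a, b) = (\<Sum>j\<in>J. y j * A i (g j) a b))"
    if J: "finite J" "g ` J \<subseteq> V" "sum y J = 1" for J :: "nat set" and g y
  proof -
    have "(q \<circ> g) ` J \<subseteq> carrier_vec n" using J(2) q(1) by auto
    from affine_combination[OF J(1) this J(3)] obtain x where x: "x \<in> carrier_vec n"
      "\<And>h. affine_fun n h \<Longrightarrow> h x = (\<Sum>j\<in>J. y j * h (q (g j)))" by auto
    have "\<phi> x = (\<Sum>j\<in>J. y j *\<^sub>R g j)"
      unfolding Finite_Cartesian_Product.vec_eq_iff
    proof
      fix c
      have "vec_nth (\<phi> x) c = (\<Sum>j\<in>J. y j * vec_nth (\<phi> (q (g j))) c)"
        using \<phi> by (intro x(2)) (simp add: affine_vec_map_iff)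
      also have "\<dots> = vec_nth (\<Sum>j\<in>J. y j *\<^sub>R g j) c"
        using J(2) q(2) by (simp add: image_subset_iff)
      finally show "vec_nth (\<phi> x) c = vec_nth (\<Sum>j\<in>J. y j *\<^sub>R g j) c" .
    qed
    moreover have "Ms i x $$ (a, b) = (\<Sum>j\<in>J. y j * A i (g j) a b)" if "i < l" "a < m" "b < m" for i a b
      unfolding A_def using aff[OF that(1)] that by (intro x(2)) (simp add: affine_mat_map_iff)
    ultimately show ?thesis using x(1) by blast
  qed
  have line: "\<phi> ((1 - t) \<cdot>\<^sub>v x + t \<cdot>\<^sub>v x') = (1 - t) *\<^sub>R \<phi> x + t *\<^sub>R \<phi> x'"
    "\<And>i a b. i < l \<Longrightarrow> a < m \<Longrightarrow> b < m \<Longrightarrow>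
      Ms i ((1 - t) \<cdot>\<^sub>v x + t \<cdot>\<^sub>v x') $$ (a, b) = (1 - t) * Ms i x $$ (a, b) + t * Ms i x' $$ (a, b)"
    if "x \<in> carrier_vec n" "x' \<in> carrier_vec n" for x x' t
    using \<phi> aff that unfolding affine_vec_map_def affine_mat_map_iff affine_fun_def by blast+
  \<comment> \<open>Otherwise some point \<open>x0\<close> has only zero blocks, and moving from
    \<open>x0\<close> towards and beyond a feasible point scales the matrices by a nonnegative
    factor. The image of this ray lies in the bounded set \<open>P\<close>, so \<open>P\<close>
    would be a point.\<close>
  have nonzero: False
    if J: "finite J" "g ` J \<subseteq> V" "sum y J = 1"
      and z: "\<And>i a b. i < l \<Longrightarrow> a < m \<Longrightarrow> b < m \<Longrightarrow> (\<Sum>j\<in>J. y j * A i (g j) a b) = 0"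
    for J :: "nat set" and g y
  proof -
    obtain x0 where x0: "x0 \<in> carrier_vec n" "\<And>i a b. i < l \<Longrightarrow> a < m \<Longrightarrow> b < m \<Longrightarrow> Ms i x0 $$ (a, b) = 0"
      using comb[OF J] z by auto
    have "\<phi> x0 = p" if "p \<in> P" for p
    proof -
      obtain x where x: "x \<in> carrier_vec n" "\<And>i. i < l \<Longrightarrow> Ms i x \<in> psd_mats m" "p = \<phi> x"
        using \<open>p \<in> P\<close> unfolding P by blast
      have "(1 - t) *\<^sub>R \<phi> x0 + t *\<^sub>R p \<in> P" if "t \<ge> 0" for t
        unfolding x(3) line(1)[OF x0(1) x(1), symmetric]
      proof (rule \<phi>_mem)
        show "(1 - t) \<cdot>\<^sub>v x0 + t \<cdot>\<^sub>v x \<in> carrier_vec n" using x0 x by simp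
        fix i w assume i: "i < l"
        have "qform m (\<lambda>a b. Ms i ((1 - t) \<cdot>\<^sub>v x0 + t \<cdot>\<^sub>v x) $$ (a, b)) w = t * qform m (\<lambda>a b. Ms i x $$ (a, b)) w"
          unfolding qform_def sum_distrib_left
          by (intro sum.cong refl) (use i x0 x line(2) in \<open>auto simp: mult_ac\<close>)
        then show "0 \<le> qform m (\<lambda>a b. Ms i ((1 - t) \<cdot>\<^sub>v x0 + t \<cdot>\<^sub>v x) $$ (a, b)) w"
          using x(2)[OF i] \<open>t \<ge> 0\<close> by (simp add: psd_mats_iff)
      qed
      then show ?thesis by (rule bounded_ray_trivial[OF bdd])
    qed
    then have "P \<subseteq> {\<phi> x0}" by auto
    then have "aff_dim P \<le> aff_dim {\<phi> x0}" by (rule aff_dim_subset)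
    then show False using dim by simp
  qed
  define coords where "coords i E F s \<longleftrightarrow> (\<forall>p<m. s p \<in> V) \<and>
    (\<forall>v\<in>V. \<forall>a<m. \<forall>b<m. A i v a b = (\<Sum>p<m. \<Sum>q<m. E p a * F v p q * E q b)) \<and>
    (\<forall>v\<in>V. \<forall>p<m. \<forall>q<m. \<bar>F v p q\<bar> \<le> real m) \<and>
    (\<forall>v\<in>V. \<forall>w. 0 \<le> qform m (F v) w) \<and>
    (\<forall>p<m. \<forall>w. (w p)\<^sup>2 \<le> qform m (F (s p)) w)" for i E F s
  have "\<exists>E F s. coords i E F s" if i: "i < l" for i
    unfolding coords_def
  proof (rule psd_family_coordinates[OF V(1) V_ne])
    show "A i v a b = A i v b a" if "v \<in> V" "a < m" "b < m" for v a b
      using Ms_sym[OF i q(1)[OF that(1)]] that by (auto simp: A_def sym_mats_iff)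
    show "0 \<le> qform m (A i v) w" if "v \<in> V" for v w
      using q(3)[OF that i] unfolding A_def[abs_def] by (simp add: psd_mats_iff)
  qed
  then obtain E G s where coords: "\<And>i. i < l \<Longrightarrow> coords i (E i) (G i) (s i)" by metis
  have s: "s i p \<in> V" if "i < l" "p < m" for i p
    using coords[OF that(1)] that unfolding coords_def by blast
  have AG: "A i v a b = (\<Sum>p<m. \<Sum>q<m. E i p a * G i v p q * E i q b)"
    if "i < l" "v \<in> V" "a < m" "b < m" for i v a b
    using coords[OF that(1)] that unfolding coords_def by blast
  have G_bound: "\<bar>G i v p q\<bar> \<le> real m" if "i < l" "v \<in> V" "p < m" "q < m" for i v p q
    using coords[OF that(1)] that unfolding coords_def by blast
  have G_psd: "0 \<le> qform m (G i v) w" if "i < l" "v \<in> V" for i v w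
    using coords[OF that(1)] that unfolding coords_def by blast
  have G_s: "(w p)\<^sup>2 \<le> qform m (G i (s i p)) w" if "i < l" "p < m" for i p w
    using coords[OF that(1)] that unfolding coords_def by blast
  \<comment> \<open>The coordinates \<open>E i\<close> do not depend on \<open>v\<close>, so linear
    combinations of normalized matrices carry over to the original ones.\<close>
  have A_comb: "(\<Sum>j\<in>J. y j * A i (g j) a b) =
      (\<Sum>p<m. \<Sum>q<m. E i p a * (\<Sum>j\<in>J. y j * G i (g j) p q) * E i q b)"
    if "i < l" "a < m" "b < m" "g ` J \<subseteq> V" for J :: "nat set" and g y i a b
  proof -
    have "(\<Sum>j\<in>J. y j * A i (g j) a b) =
      (\<Sum>j\<in>J. \<Sum>p<m. \<Sum>q<m. y j * (E i p a * G i (g j) p q * E i q b))"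
      using that by (intro sum.cong refl) (auto simp: AG image_subset_iff sum_distrib_left)
    also have "\<dots> = (\<Sum>p<m. \<Sum>j\<in>J. \<Sum>q<m. y j * (E i p a * G i (g j) p q * E i q b))"
      by (rule sum.swap)
    also have "\<dots> = (\<Sum>p<m. \<Sum>q<m. \<Sum>j\<in>J. y j * (E i p a * G i (g j) p q * E i q b))"
      by (intro sum.cong refl sum.swap)
    finally show ?thesis by (simp add: sum_distrib_left sum_distrib_right mult_ac)
  qed
  \<comment> \<open>All entries of all blocks are spanned jointly, so that the same coefficients
    work for every block; \<open>K\<close> has \<open>N\<close> elements.\<close>
  define K where "K = {..<l} \<times> {..<m} \<times> {..<m}"
  have finK: "finite K" by (simp add: K_def)
  obtain n0 e coef where n0: "n0 \<le> card K" and e: "e ` {..<n0} \<subseteq> V"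
    and expand: "\<And>v r. v \<in> V \<Longrightarrow> r \<in> K \<Longrightarrow> (case r of (i, a, b) \<Rightarrow> G i v a b) =
      (\<Sum>j<n0. coef v j * (case r of (i, a, b) \<Rightarrow> G i (e j) a b))"
    and coef: "\<And>v j. v \<in> V \<Longrightarrow> j < n0 \<Longrightarrow> \<bar>coef v j\<bar> \<le> 1"
    by (rule barycentric_spanner[OF V(1) finK, of "\<lambda>v r. case r of (i, a, b) \<Rightarrow> G i v a b"]) (rule that)
  have n0N: "n0 \<le> N" using n0 by (simp add: K_def N_def mult.assoc)
  have expandG: "G i v a b = (\<Sum>j<n0. coef v j * G i (e j) a b)"
    if "v \<in> V" "i < l" "a < m" "b < m" for v i a b
    using expand[of v "(i, a, b)"] that by (simp add: K_def)
  have row: "sum (coef v) {..<n0} = 1" if v: "v \<in> V" for v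
  proof (rule ccontr)
    assume *: "sum (coef v) {..<n0} \<noteq> 1"
    \<comment> \<open>The dependence \<open>G i v = \<Sum> coef v j * G i (e j)\<close>, read as a
      vanishing combination with total weight \<open>\<sigma>\<close>, becomes an affine combination
      of the value 0 after division by \<open>\<sigma>\<close>, which \<open>nonzero\<close>
      excludes. The point \<open>v\<close> takes the extra index \<open>n0\<close>.\<close>
    define \<sigma> where "\<sigma> = 1 - sum (coef v) {..<n0}"
    have \<sigma>: "\<sigma> \<noteq> 0" using * by (simp add: \<sigma>_def)
    define g where "g j = (if j = n0 then v else e j)" for j
    define y where "y j = (if j = n0 then 1 else - coef v j) / \<sigma>" for j
    show False
    proof (rule nonzero[of "{..<Suc n0}" g y])
      show gV: "g ` {..<Suc n0} \<subseteq> V" using e v by (auto simp: g_def)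
      have "(\<Sum>j<n0. y j) = - sum (coef v) {..<n0} / \<sigma>"
        unfolding sum_negf[symmetric] sum_divide_distrib by (intro sum.cong) (auto simp: y_def)
      then have "sum y {..<Suc n0} = (1 - sum (coef v) {..<n0}) / \<sigma>" by (simp add: y_def diff_divide_distrib)
      then show "sum y {..<Suc n0} = 1" using \<sigma> by (simp add: \<sigma>_def)
      fix i a b assume iab: "i < l" "a < m" "b < m"
      have "(\<Sum>j<Suc n0. y j * G i (g j) p q) = 0" if "p < m" "q < m" for p q
      proof -
        have "(\<Sum>j<n0. y j * G i (g j) p q) = (\<Sum>j<n0. - (coef v j * G i (e j) p q) / \<sigma>)"
          by (intro sum.cong) (auto simp: y_def g_def)
        also have "\<dots> = - G i v p q / \<sigma>"
          using expandG[OF v iab(1) that] by (simp add: sum_negf flip: sum_divide_distrib)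
        finally show ?thesis by (simp add: y_def g_def)
      qed
      then show "(\<Sum>j<Suc n0. y j * A i (g j) a b) = 0"
        unfolding A_comb[OF iab gV] by simp
    qed simp
  qed
  have n0_pos: "n0 > 0" using row V_ne by (cases n0) auto
  \<comment> \<open>The spanner may have fewer than \<open>N\<close> members; the remaining slots
    repeat \<open>e 0\<close> and receive coefficient 0 in \<open>y\<close>.\<close>
  define t where "t j = (if j < n0 then e j else e 0)" for j
  define F where "F j i = G i (t j)" for j i
  define y where "y v j = (if j < n0 then coef v j else 0)" for v j
  have tV: "t j \<in> V" for j using e n0_pos by (auto simp: t_def)
  then have tN: "t ` {..<N} \<subseteq> V" by blast
  have cut: "(\<Sum>j<N. y v j *\<^sub>R h j) = (\<Sum>j<n0. coef v j *\<^sub>R h j)" for v and h :: "nat \<Rightarrow> 'z :: real_vector"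
  proof -
    have "(\<Sum>j<N. y v j *\<^sub>R h j) = (\<Sum>j<n0. y v j *\<^sub>R h j)"
      using n0N by (intro sum.mono_neutral_right) (auto simp: y_def)
    then show ?thesis by (simp add: y_def)
  qed
  have y_sum: "sum (y v) {..<N} = 1" if "v \<in> V" for v
    using cut[of v "\<lambda>_. 1 :: real"] row[OF that] by simp
  have y_bound: "\<bar>y v j\<bar> \<le> 1" if "v \<in> V" for v j using coef[OF that] by (simp add: y_def)
  have y_G: "(\<Sum>j<N. y v j * F j i a b) = G i v a b" if "v \<in> V" "i < l" "a < m" "b < m" for v i a b
    using cut[of v "\<lambda>j. F j i a b"] expandG[OF that] by (simp add: F_def t_def)
  have y_t: "(\<Sum>j<N. y v j *\<^sub>R t j) = v" if v: "v \<in> V" for v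
  proof -
    obtain x where x: "x \<in> carrier_vec n" "\<phi> x = (\<Sum>j<N. y v j *\<^sub>R t j)"
      and Mx: "\<And>i a b. i < l \<Longrightarrow> a < m \<Longrightarrow> b < m \<Longrightarrow> Ms i x $$ (a, b) = (\<Sum>j<N. y v j * A i (t j) a b)"
      using comb[OF finite_lessThan tN y_sum[OF v]] by blast
    have Mx_eq: "Ms i x $$ (a, b) = Ms i (q v) $$ (a, b)" if "i < l" "a < m" "b < m" for i a b
    proof -
      have "Ms i x $$ (a, b) = (\<Sum>p<m. \<Sum>q<m. E i p a * (\<Sum>j<N. y v j * F j i p q) * E i q b)"
        unfolding F_def using Mx[OF that] A_comb[OF that tN] by simp
      also have "\<dots> = A i v a b" using y_G[OF v that(1)] AG[OF that(1) v that(2,3)] by simp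
      finally show ?thesis by (simp add: A_def)
    qed
    \<comment> \<open>The points \<open>x\<close> and \<open>q v\<close> may differ, but their
      matrices agree. Hence the whole line through them is feasible, and boundedness of its image
      makes \<open>\<phi>\<close> constant on it.\<close>
    have "(1 - \<tau>) *\<^sub>R v + \<tau> *\<^sub>R \<phi> x \<in> P" for \<tau>
    proof -
      have "\<phi> ((1 - \<tau>) \<cdot>\<^sub>v q v + \<tau> \<cdot>\<^sub>v x) \<in> P"
      proof (rule \<phi>_mem)
        show "(1 - \<tau>) \<cdot>\<^sub>v q v + \<tau> \<cdot>\<^sub>v x \<in> carrier_vec n" using q(1)[OF v] x by simp
        fix i w assume i: "i < l"
        have "Ms i ((1 - \<tau>) \<cdot>\<^sub>v q v + \<tau> \<cdot>\<^sub>v x) $$ (a, b) = Ms i (q v) $$ (a, b)" if "a < m" "b < m" for a b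
          using line(2)[OF q(1)[OF v] x(1) i that] Mx_eq[OF i that] by (simp add: algebra_simps)
        then have "qform m (\<lambda>a b. Ms i ((1 - \<tau>) \<cdot>\<^sub>v q v + \<tau> \<cdot>\<^sub>v x) $$ (a, b)) w = qform m (\<lambda>a b. Ms i (q v) $$ (a, b)) w"
          by (simp add: qform_def)
        then show "0 \<le> qform m (\<lambda>a b. Ms i ((1 - \<tau>) \<cdot>\<^sub>v q v + \<tau> \<cdot>\<^sub>v x) $$ (a, b)) w"
          using q(3)[OF v i] by (simp add: psd_mats_iff)
      qed
      then show ?thesis using line(1)[OF q(1)[OF v] x(1)] q(2)[OF v] by simp
    qed
    then have "v = \<phi> x" by (intro bounded_ray_trivial[OF bdd])
    then show ?thesis using x by simp
  qed
  \<comment> \<open>The index set is generic because it is used for \<open>V\<close> itself and for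
    the pairs of a block and a coordinate that form the center.\<close>
  have pencil_rows: "qform m (pencil N F (\<lambda>j. \<Sum>x\<in>X. u x * y (g x) j) i) w = (\<Sum>x\<in>X. u x * qform m (G i (g x)) w)"
    if "i < l" "g ` X \<subseteq> V" for X :: "'x set" and u g i w
  proof -
    have "pencil N F (\<lambda>j. \<Sum>x\<in>X. u x * y (g x) j) i a b = (\<Sum>x\<in>X. u x * G i (g x) a b)" if "a < m" "b < m" for a b
    proof -
      have "pencil N F (\<lambda>j. \<Sum>x\<in>X. u x * y (g x) j) i a b = (\<Sum>j<N. \<Sum>x\<in>X. u x * (y (g x) j * F j i a b))"
        by (simp add: pencil_def sum_distrib_right mult.assoc)
      also have "\<dots> = (\<Sum>x\<in>X. \<Sum>j<N. u x * (y (g x) j * F j i a b))" by (rule sum.swap)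
      also have "\<dots> = (\<Sum>x\<in>X. u x * G i (g x) a b)"
        using \<open>g ` X \<subseteq> V\<close> \<open>i < l\<close> that by (intro sum.cong refl) (auto simp: y_G image_subset_iff simp flip: sum_distrib_left)
      finally show ?thesis .
    qed
    then have "qform m (pencil N F (\<lambda>j. \<Sum>x\<in>X. u x * y (g x) j) i) w = qform m (\<lambda>a b. \<Sum>x\<in>X. u x * G i (g x) a b) w"
      by (simp add: qform_def)
    then show ?thesis by (simp add: qform_sum)
  qed
  show ?thesis
    unfolding normalized_ef_def N_def[symmetric]
  proof (intro exI[of _ t] exI[of _ F] conjI allI impI ballI)
    show "t j \<in> P" for j using tV VP by blast
    show "\<bar>F j i a b\<bar> \<le> real m" if "i < l" "a < m" "b < m" for j i a b
      using G_bound tV that by (simp add: F_def)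
  next
    fix z :: "nat \<Rightarrow> real" assume z: "sum z {..<N} = 1" and feas: "\<forall>i<l. \<forall>w. 0 \<le> qform m (pencil N F z i) w"
    obtain x where x: "x \<in> carrier_vec n" "\<phi> x = (\<Sum>j<N. z j *\<^sub>R t j)"
      and Mx: "\<And>i a b. i < l \<Longrightarrow> a < m \<Longrightarrow> b < m \<Longrightarrow> Ms i x $$ (a, b) = (\<Sum>j<N. z j * A i (t j) a b)"
      using comb[OF finite_lessThan tN z] by blast
    have "\<phi> x \<in> P"
    proof (rule \<phi>_mem[OF x(1)])
      fix i w assume i: "i < l"
      have "Ms i x $$ (a, b) = (\<Sum>p<m. \<Sum>q<m. E i p a * pencil N F z i p q * E i q b)" if "a < m" "b < m" for a b
        unfolding pencil_def F_def using Mx[OF i that] A_comb[OF i that tN] by simp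
      then have "qform m (\<lambda>a b. Ms i x $$ (a, b)) w =
        qform m (\<lambda>a b. \<Sum>p<m. \<Sum>q<m. E i p a * pencil N F z i p q * E i q b) w"
        by (simp add: qform_def)
      then show "0 \<le> qform m (\<lambda>a b. Ms i x $$ (a, b)) w" using feas i by (simp add: qform_congruence)
    qed
    then show "(\<Sum>j<N. z j *\<^sub>R t j) \<in> P" using x by simp
  next
    fix p assume "p \<in> P"
    then obtain u where u: "\<And>v. v \<in> V \<Longrightarrow> 0 \<le> u v" "sum u V = 1" "(\<Sum>v\<in>V. u v *\<^sub>R v) = p"
      unfolding V(2) convex_hull_finite[OF V(1)] by blast
    let ?Y = "\<lambda>j. \<Sum>v\<in>V. u v * y v j"
    show "\<exists>y. sum y {..<N} = 1 \<and> (\<forall>j<N. \<bar>y j\<bar> \<le> 1) \<and>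
      (\<forall>i<l. \<forall>w. 0 \<le> qform m (pencil N F y i) w) \<and> p = (\<Sum>j<N. y j *\<^sub>R t j)"
    proof (intro exI[of _ ?Y] conjI allI impI)
      show "sum ?Y {..<N} = 1"
        by (rule convex_combination_rows(1)) (use u y_sum y_bound in auto)
      show "\<bar>?Y j\<bar> \<le> 1" if "j < N" for j
        by (rule convex_combination_rows(2)[OF _ _ _ _ that]) (use u y_sum y_bound in auto)
      show "0 \<le> qform m (pencil N F ?Y i) w" if "i < l" for i w
        using pencil_rows[OF that, of "\<lambda>v. v" V u w] u(1) G_psd[OF that] by (auto intro!: sum_nonneg)
      have "(\<Sum>j<N. ?Y j *\<^sub>R t j) = (\<Sum>v\<in>V. u v *\<^sub>R (\<Sum>j<N. y v j *\<^sub>R t j))"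
        by (rule convex_combination_rows(3)) (use u y_sum y_bound in auto)
      then show "p = (\<Sum>j<N. ?Y j *\<^sub>R t j)" using u(3) by (simp add: y_t)
    qed
  next
    define X where "X = {..<l} \<times> {..<m}"
    \<comment> \<open>The center is the uniform average over all pairs. For block \<open>i\<close>,
      the pairs with first component \<open>i\<close> contribute the sum of squares and the other
      pairs something nonnegative.\<close>
    define u where "u x = 1 / (real l * real m)" for x :: "nat \<times> nat"
    define g where "g x = s (fst x) (snd x)" for x
    have gV: "g x \<in> V" if "x \<in> X" for x using that s by (auto simp: g_def X_def)
    then have gXV: "g ` X \<subseteq> V" by blast
    have u: "\<And>x. x \<in> X \<Longrightarrow> 0 \<le> u x" "sum u X = 1" using lm by (auto simp: u_def X_def)
    let ?Y = "\<lambda>j. \<Sum>x\<in>X. u x * y (g x) j"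
    show "\<exists>y. sum y {..<N} = 1 \<and> (\<forall>j<N. \<bar>y j\<bar> \<le> 1) \<and>
      (\<forall>i<l. \<forall>w. (\<Sum>a<m. (w a)\<^sup>2) / (real l * real m) \<le> qform m (pencil N F y i) w)"
    proof (intro exI[of _ ?Y] conjI allI impI)
      show "sum ?Y {..<N} = 1"
        by (rule convex_combination_rows(1)) (use u y_sum y_bound gV in auto)
      show "\<bar>?Y j\<bar> \<le> 1" if "j < N" for j
        by (rule convex_combination_rows(2)[OF _ _ _ _ that]) (use u y_sum y_bound gV in auto)
      fix i w assume i: "i < l"
      have "(\<Sum>a<m. (w a)\<^sup>2) \<le> (\<Sum>a<m. qform m (G i (s i a)) w)"
        using G_s[OF i] by (intro sum_mono) auto
      also have "\<dots> = (\<Sum>x\<in>{i} \<times> {..<m}. qform m (G i (g x)) w)"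
        by (simp add: g_def sum.cartesian_product')
      also have "\<dots> \<le> (\<Sum>x\<in>X. qform m (G i (g x)) w)"
        using i gV G_psd[OF i] by (intro sum_mono2) (auto simp: X_def)
      finally have "(\<Sum>a<m. (w a)\<^sup>2) / (real l * real m) \<le> (\<Sum>x\<in>X. qform m (G i (g x)) w) / (real l * real m)"
        by (rule divide_right_mono) simp
      also have "\<dots> = qform m (pencil N F ?Y i) w"
        using pencil_rows[OF i gXV, of u w] by (simp add: u_def sum_divide_distrib)
      finally show "(\<Sum>a<m. (w a)\<^sup>2) / (real l * real m) \<le> qform m (pencil N F ?Y i) w" .
    qed
  qed
qed

section \<open>Perturbation and counting\<close>

text \<open>The forms differ by at most \<eta> times the squared sum of the absolute values of
  \<open>w\<close>, and Cauchy-Schwarz turns that square into \<open>m\<close> times the sum of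
  squares.\<close>

lemma qform_perturbation:
  assumes "\<And>a b. a < m \<Longrightarrow> b < m \<Longrightarrow> \<bar>A a b - B a b\<bar> \<le> \<eta>" "0 \<le> \<eta>"
  shows "qform m A w - \<eta> * real m * (\<Sum>a<m. (w a)\<^sup>2) \<le> qform m B w"
proof -
  have "qform m A w - qform m B w = (\<Sum>a<m. \<Sum>b<m. w a * (A a b - B a b) * w b)"
    by (simp add: qform_def sum_subtractf algebra_simps)
  also have "\<dots> \<le> (\<Sum>a<m. \<Sum>b<m. \<eta> * (\<bar>w a\<bar> * \<bar>w b\<bar>))"
  proof (intro sum_mono)
    fix a b assume "a \<in> {..<m}" "b \<in> {..<m}"
    then have "\<bar>A a b - B a b\<bar> * (\<bar>w a\<bar> * \<bar>w b\<bar>) \<le> \<eta> * (\<bar>w a\<bar> * \<bar>w b\<bar>)"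
      using assms(1) by (intro mult_right_mono) auto
    moreover have "w a * (A a b - B a b) * w b \<le> \<bar>w a * (A a b - B a b) * w b\<bar>" by simp
    ultimately show "w a * (A a b - B a b) * w b \<le> \<eta> * (\<bar>w a\<bar> * \<bar>w b\<bar>)"
      by (simp add: abs_mult mult_ac)
  qed
  also have "\<dots> = \<eta> * (\<Sum>a<m. \<bar>w a\<bar>)\<^sup>2"
    unfolding power2_eq_square sum_product by (simp only: sum_distrib_left)
  also have "\<dots> \<le> \<eta> * ((\<Sum>a<m. \<bar>w a\<bar>\<^sup>2) * real (card {..<m}))"
    using assms(2) by (intro mult_left_mono sum_squared_le_sum_of_squares)
  finally show ?thesis by (simp add: mult_ac)
qed

text \<open>The coefficients of \<open>p\<close> need not be feasible for \<open>F'\<close>. Moving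
  them by the fraction \<open>s\<close> towards the center of \<open>P\<close> restores feasibility;
  this costs a distance of at most \<open>2 * \<rho> * s\<close>, and the change of the points
  \<open>t j\<close> costs at most \<open>real N * \<tau>\<close>.\<close>

lemma normalized_ef_perturbation:
  assumes ef: "normalized_ef P l m N t F" and ef': "normalized_ef P' l m N t' F'"
    and lm: "1 \<le> l" "1 \<le> m"
    and F: "\<And>j i a b. \<lbrakk>j < N; i < l; a < m; b < m\<rbrakk> \<Longrightarrow> \<bar>F j i a b - F' j i a b\<bar> \<le> \<epsilon>"
    and t: "\<And>j. j < N \<Longrightarrow> norm (t j - t' j) \<le> \<tau>"
    and P: "P \<subseteq> cball 0 \<rho>" and \<epsilon>: "0 \<le> \<epsilon>" and s: "s = real N * \<epsilon> * real m * (real l * real m)" "s \<le> 1"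
    and p: "p \<in> P"
  shows "\<exists>p'\<in>P'. dist p p' \<le> 2 * \<rho> * s + real N * \<tau>"
proof -
  obtain y where y: "sum y {..<N} = 1" "\<forall>j<N. \<bar>y j\<bar> \<le> 1"
    "\<forall>i<l. \<forall>w. 0 \<le> qform m (pencil N F y i) w" "p = (\<Sum>j<N. y j *\<^sub>R t j)"
    using normalized_ef_complete[OF ef p] by (elim exE conjE) (rule that)
  obtain c where c: "sum c {..<N} = 1" "\<forall>j<N. \<bar>c j\<bar> \<le> 1"
    "\<forall>i<l. \<forall>w. (\<Sum>a<m. (w a)\<^sup>2) / (real l * real m) \<le> qform m (pencil N F c i) w"
    using normalized_ef_center[OF ef] by (elim exE conjE) (rule that)
  have s0: "0 \<le> s" using \<epsilon> by (simp add: s)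
  define z where "z j = (1 - s) * y j + s * c j" for j
  have z_sum: "sum z {..<N} = 1" using y(1) c(1) by (simp add: z_def sum.distrib flip: sum_distrib_left)
  have z_bound: "\<bar>z j\<bar> \<le> 1" if "j < N" for j
  proof -
    have "\<bar>z j\<bar> \<le> (1 - s) * \<bar>y j\<bar> + s * \<bar>c j\<bar>"
      using abs_triangle_ineq[of "(1 - s) * y j" "s * c j"] s(2) s0 by (simp add: z_def abs_mult)
    also have "\<dots> \<le> (1 - s) * 1 + s * 1" using y(2) c(2) that s(2) s0 by (intro add_mono mult_left_mono) auto
    finally show ?thesis by simp
  qed
  have pencil_z: "qform m (pencil N F z i) w = (1 - s) * qform m (pencil N F y i) w + s * qform m (pencil N F c i) w" for i w
    unfolding pencil_def qform_sum z_def
    by (simp add: sum_distrib_left sum.distrib distrib_right mult.assoc)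
  have center: "(\<Sum>j<N. c j *\<^sub>R t j) \<in> P"
  proof -
    have "0 \<le> qform m (pencil N F c i) w" if "i < l" for i w
      using order_trans[OF _ c(3)[rule_format, OF that]] by (simp add: sum_nonneg)
    then show ?thesis using c(1) by (intro normalized_ef_sound[OF ef]) auto
  qed
  have feas: "0 \<le> qform m (pencil N F' z i) w" if i: "i < l" for i w
  proof -
    have "\<bar>pencil N F z i a b - pencil N F' z i a b\<bar> \<le> real N * \<epsilon>" if ab: "a < m" "b < m" for a b
    proof -
      have "pencil N F z i a b - pencil N F' z i a b = (\<Sum>j<N. z j * (F j i a b - F' j i a b))"
        by (simp add: pencil_def sum_subtractf algebra_simps)
      also have "\<bar>\<dots>\<bar> \<le> (\<Sum>j<N. \<bar>z j * (F j i a b - F' j i a b)\<bar>)" by (rule sum_abs)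
      also have "\<dots> \<le> (\<Sum>j<N. 1 * \<epsilon>)"
        unfolding abs_mult using z_bound F i ab by (intro sum_mono mult_mono) auto
      finally show ?thesis by simp
    qed
    then have "qform m (pencil N F z i) w - real N * \<epsilon> * real m * (\<Sum>a<m. (w a)\<^sup>2) \<le> qform m (pencil N F' z i) w"
      using \<epsilon> by (intro qform_perturbation) auto
    moreover have "s * ((\<Sum>a<m. (w a)\<^sup>2) / (real l * real m)) \<le> qform m (pencil N F z i) w"
      unfolding pencil_z
      using mult_nonneg_nonneg[of "1 - s", OF _ y(3)[rule_format, OF i, of w]] s(2)
        mult_left_mono[OF c(3)[rule_format, OF i, of w] s0] by simp
    \<comment> \<open>The value of \<open>s\<close> is chosen for this equality: the slack gained
      from the center equals the bound on the perturbation loss.\<close>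
    moreover have "s * ((\<Sum>a<m. (w a)\<^sup>2) / (real l * real m)) = real N * \<epsilon> * real m * (\<Sum>a<m. (w a)\<^sup>2)"
      using lm by (simp add: s)
    ultimately show ?thesis by linarith
  qed
  show ?thesis
  proof (intro bexI)
    show "(\<Sum>j<N. z j *\<^sub>R t' j) \<in> P'" by (rule normalized_ef_sound[OF ef' z_sum feas])
    let ?c = "\<Sum>j<N. c j *\<^sub>R t j"
    have "p - (\<Sum>j<N. z j *\<^sub>R t' j) = s *\<^sub>R (p - ?c) + (\<Sum>j<N. z j *\<^sub>R (t j - t' j))"
    proof -
      have "(\<Sum>j<N. z j *\<^sub>R t j) = (1 - s) *\<^sub>R p + s *\<^sub>R ?c"
        unfolding y(4) z_def by (simp add: scaleR_add_left sum.distrib scaleR_sum_right)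
      then show ?thesis by (simp add: scaleR_diff_right sum_subtractf scaleR_diff_left algebra_simps)
    qed
    then have "dist p (\<Sum>j<N. z j *\<^sub>R t' j) \<le> norm (s *\<^sub>R (p - ?c)) + norm (\<Sum>j<N. z j *\<^sub>R (t j - t' j))"
      by (simp only: dist_norm norm_triangle_ineq)
    also have "norm (s *\<^sub>R (p - ?c)) \<le> s * (2 * \<rho>)"
    proof -
      have "norm p \<le> \<rho>" "norm ?c \<le> \<rho>" using P p center by auto
      then have "norm (p - ?c) \<le> 2 * \<rho>" using norm_triangle_ineq4[of p ?c] by linarith
      then show ?thesis using s0 by (simp add: mult_left_mono)
    qed
    also have "norm (\<Sum>j<N. z j *\<^sub>R (t j - t' j)) \<le> (\<Sum>j<N. 1 * \<tau>)"
    proof (rule order_trans[OF norm_sum], rule sum_mono)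
      fix j assume "j \<in> {..<N}"
      then show "norm (z j *\<^sub>R (t j - t' j)) \<le> 1 * \<tau>"
        unfolding norm_scaleR using z_bound t by (intro mult_mono) auto
    qed
    finally show "dist p (\<Sum>j<N. z j *\<^sub>R t' j) \<le> 2 * \<rho> * s + real N * \<tau>" by (simp add: mult_ac)
  qed
qed

lemma hausdorff_dist_le:
  fixes X Y :: "(real ^ 'd) set"
  assumes "X \<noteq> {}" "Y \<noteq> {}" "\<And>x. x \<in> X \<Longrightarrow> \<exists>y\<in>Y. dist x y \<le> \<delta>" "\<And>y. y \<in> Y \<Longrightarrow> \<exists>x\<in>X. dist y x \<le> \<delta>"
  shows "hausdorff_dist X Y \<le> \<delta>"
  unfolding hausdorff_dist_def using assms
  by (intro max.boundedI cSUP_least) (auto intro: infdist_le2)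

section \<open>Nets and the number of codes\<close>

text \<open>A maximal \<open>r\<close>-separated subset of the ball is a net. The balls of radius
  \<open>r / 2\<close> around its points are disjoint and lie in the ball of radius
  \<open>\<rho> + r / 2\<close>, so comparing volumes bounds their number; this bound also shows
  that a maximal subset exists.\<close>

lemma cball_net:
  assumes \<rho>: "0 \<le> \<rho>" and r: "0 < r"
  shows "\<exists>C :: 'a :: euclidean_space set. finite C \<and>
    real (card C) \<le> (1 + 2 * \<rho> / r) ^ DIM('a) \<and> cball 0 \<rho> \<subseteq> (\<Union>c\<in>C. cball c r)"
proof -
  define S where "S C \<longleftrightarrow> finite C \<and> C \<subseteq> cball 0 \<rho> \<and> (\<forall>x\<in>C. \<forall>y\<in>C. x \<noteq> y \<longrightarrow> r < dist x y)" for C :: "'a set"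
  define \<kappa> where "\<kappa> = unit_ball_vol (real DIM('a))"
  have \<kappa>: "\<kappa> > 0" by (simp add: \<kappa>_def)
  have bound: "real (card C) \<le> (1 + 2 * \<rho> / r) ^ DIM('a)" if C: "S C" for C
  proof -
    have disj: "disjoint_family_on (\<lambda>c. ball c (r / 2)) C"
      unfolding disjoint_family_on_def
    proof (intro ballI impI)
      fix x y assume "x \<in> C" "y \<in> C" "x \<noteq> y"
      then have "r < dist x y" using C by (auto simp: S_def)
      then show "ball x (r / 2) \<inter> ball y (r / 2) = {}" by (intro disjoint_ballI) auto
    qed
    have "real (card C) * (\<kappa> * (r / 2) ^ DIM('a)) = (\<Sum>c\<in>C. measure lborel (ball c (r / 2)))"
      using r by (simp add: content_ball \<kappa>_def)
    also have "\<dots> = measure lborel (\<Union>c\<in>C. ball c (r / 2))"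
      using C disj by (intro measure_finite_Union[symmetric]) (auto simp: S_def emeasure_ball less_imp_le[OF r])
    also have "\<dots> \<le> measure lborel (cball (0 :: 'a) (\<rho> + r / 2))"
    proof (rule measure_mono_fmeasurable)
      show "(\<Union>c\<in>C. ball c (r / 2)) \<subseteq> cball 0 (\<rho> + r / 2)"
      proof clarsimp
        fix c x assume "c \<in> C" "dist c x * 2 < r"
        then show "norm x \<le> \<rho> + r / 2"
          using C norm_triangle_ineq[of c "x - c"] by (auto simp: S_def dist_norm norm_minus_commute)
      qed
      show "(\<Union>c\<in>C. ball c (r / 2)) \<in> sets lborel" by (simp add: borel_open open_UN)
      show "cball (0 :: 'a) (\<rho> + r / 2) \<in> fmeasurable lborel"
        using \<rho> r by (intro fmeasurableI) (auto simp: emeasure_cball)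
    qed
    also have "\<dots> = \<kappa> * (\<rho> + r / 2) ^ DIM('a)" using \<rho> r by (simp add: content_cball \<kappa>_def)
    finally have "real (card C) * (r / 2) ^ DIM('a) \<le> (\<rho> + r / 2) ^ DIM('a)" using \<kappa> by simp
    then have "real (card C) \<le> (\<rho> + r / 2) ^ DIM('a) / (r / 2) ^ DIM('a)" using r by (simp add: pos_le_divide_eq)
    also have "\<dots> = ((\<rho> + r / 2) / (r / 2)) ^ DIM('a)" by (simp only: power_divide)
    also have "(\<rho> + r / 2) / (r / 2) = 1 + 2 * \<rho> / r" using r by (simp add: field_simps)
    finally show ?thesis .
  qed
  have "S {}" by (simp add: S_def)
  moreover have "\<forall>C. S C \<longrightarrow> card C < Suc (nat \<lfloor>(1 + 2 * \<rho> / r) ^ DIM('a)\<rfloor>)"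
    using bound by (auto simp: less_Suc_eq_le le_nat_floor)
  ultimately obtain C where C: "S C" and max: "\<And>C'. S C' \<Longrightarrow> card C' \<le> card C"
    using ex_has_greatest_nat[of S "{}" card] by blast
  have "cball 0 \<rho> \<subseteq> (\<Union>c\<in>C. cball c r)"
  proof (rule ccontr)
    assume "\<not> ?thesis"
    then obtain x where x: "x \<in> cball 0 \<rho>" "\<And>c. c \<in> C \<Longrightarrow> r < dist c x" by fastforce
    then have "x \<notin> C" using r by force
    moreover have "S (insert x C)" using C x by (auto simp: S_def dist_commute)
    ultimately show False using max[of "insert x C"] C by (simp add: S_def)
  qed
  then show ?thesis using C bound by (auto simp: S_def)
qed

text \<open>The code of \<open>P\<close> consists of the entries of \<open>F\<close> rounded to the
  grid of width \<open>\<epsilon>\<close> and of net points near the \<open>t j\<close>. Equal codes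
  force a Hausdorff distance below \<Delta> by \<open>normalized_ef_perturbation\<close>, so the
  code is injective and the codes are counted.\<close>

lemma card_separated_normalized_ef:
  fixes \<P> :: "(real ^ 'd) set set"
  assumes lm: "1 \<le> l" "1 \<le> m" and fin: "finite \<P>"
    and ef: "\<And>P. P \<in> \<P> \<Longrightarrow> normalized_ef P l m (l * m * m) (t P) (F P)"
    and ne: "\<And>P. P \<in> \<P> \<Longrightarrow> P \<noteq> {}"
    and ball: "\<And>P. P \<in> \<P> \<Longrightarrow> P \<subseteq> cball 0 \<rho>"
    and \<rho>: "0 < \<rho>" and \<Delta>: "0 < \<Delta>" "\<Delta> \<le> 2 * \<rho>"
    and sep: "\<And>P P'. P \<in> \<P> \<Longrightarrow> P' \<in> \<P> \<Longrightarrow> P \<noteq> P' \<Longrightarrow> \<Delta> \<le> hausdorff_dist P P'"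
  defines "N \<equiv> l * m * m" and "u \<equiv> 2 * \<rho> / \<Delta>"
  shows "real (card \<P>) \<le> (10 * u * real N ^ 3) ^ (N * N) * ((5 * real N * u) ^ CARD('d)) ^ N"
proof -
  have u: "1 \<le> u" using \<Delta> by (simp add: u_def)
  have N1: "1 \<le> N" using lm by (simp add: N_def)
  have mN: "m \<le> N" using lm by (simp add: N_def)
  \<comment> \<open>With this choice the shift \<open>s\<close> of the perturbation lemma is
    \<open>1 / (4 * u)\<close>, which costs \<Delta>/4; the points \<open>t j\<close> differ by at
    most \<open>2 * r\<close> and cost \<Delta>/2. The total of 3/4 \<Delta> is below
    \<Delta>.\<close>
  define \<epsilon> where "\<epsilon> = 1 / (4 * u * real N ^ 2)"
  define r where "r = \<Delta> / (4 * real N)"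
  have \<epsilon>: "0 < \<epsilon>" using u N1 by (simp add: \<epsilon>_def)
  have r: "0 < r" using \<Delta> N1 by (simp add: r_def)
  obtain C :: "(real ^ 'd) set" where C: "finite C" "real (card C) \<le> (1 + 2 * \<rho> / r) ^ DIM(real ^ 'd)"
    "cball 0 \<rho> \<subseteq> (\<Union>c\<in>C. cball c r)"
    using cball_net[of \<rho> r, where ?'a = "real ^ 'd"] \<rho> r by auto
  have "\<forall>x\<in>cball 0 \<rho>. \<exists>c. c \<in> C \<and> dist c x \<le> r"
  proof
    fix x :: "real ^ 'd" assume "x \<in> cball 0 \<rho>"
    then obtain c where "c \<in> C" "x \<in> cball c r" using C(3) by blast
    then show "\<exists>c. c \<in> C \<and> dist c x \<le> r" by auto
  qed
  then obtain net where "\<forall>x\<in>cball 0 \<rho>. net x \<in> C \<and> dist (net x) x \<le> r"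
    unfolding bchoice_iff by (elim exE) (rule that)
  then have net: "\<And>x. x \<in> cball 0 \<rho> \<Longrightarrow> net x \<in> C" "\<And>x. x \<in> cball 0 \<rho> \<Longrightarrow> dist (net x) x \<le> r"
    by blast+
  define K where "K = {..<N} \<times> {..<l} \<times> {..<m} \<times> {..<m}"
  define Z where "Z = {\<lfloor>- real m / \<epsilon>\<rfloor>..\<lfloor>real m / \<epsilon>\<rfloor>}"
  define codeF where "codeF P = (\<lambda>(j, i, a, b)\<in>K. \<lfloor>F P j i a b / \<epsilon>\<rfloor>)" for P
  define codeT where "codeT P = (\<lambda>j\<in>{..<N}. net (t P j))" for P
  have t_ball: "t P j \<in> cball 0 \<rho>" if "P \<in> \<P>" "j < N" for P j
    using normalized_ef_mem[OF ef[OF that(1)]] ball[OF that(1)] that(2) unfolding N_def by blast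
  have F_bound: "\<bar>F P j i a b\<bar> \<le> real m" if "P \<in> \<P>" "j < N" "i < l" "a < m" "b < m" for P j i a b
    using normalized_ef_bound[OF ef[OF that(1)]] that(2-) unfolding N_def by blast
  have close: "\<exists>p'\<in>P'. dist p p' \<le> 3 / 4 * \<Delta>"
    if PP: "P \<in> \<P>" "P' \<in> \<P>" and code: "codeF P = codeF P'" "codeT P = codeT P'" and p: "p \<in> P" for P P' p
  proof -
    let ?s = "real N * \<epsilon> * real m * (real l * real m)"
    have s: "?s = 1 / (4 * u)"
      using N1 by (simp add: \<epsilon>_def N_def power2_eq_square mult_ac)
    have "\<exists>p'\<in>P'. dist p p' \<le> 2 * \<rho> * ?s + real N * (2 * r)"
    proof (rule normalized_ef_perturbation[OF ef[OF PP(1), folded N_def] ef[OF PP(2), folded N_def] lm _ _ ball[OF PP(1)]])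
      fix j i a b assume jiab: "j < N" "i < l" "a < m" "b < m"
      have "\<lfloor>F P j i a b / \<epsilon>\<rfloor> = \<lfloor>F P' j i a b / \<epsilon>\<rfloor>"
        using fun_cong[OF code(1), of "(j, i, a, b)"] jiab by (simp add: codeF_def K_def)
      then have "\<bar>F P j i a b / \<epsilon> - F P' j i a b / \<epsilon>\<bar> \<le> 1" by linarith
      then show "\<bar>F P j i a b - F P' j i a b\<bar> \<le> \<epsilon>"
        using \<epsilon> by (simp add: abs_le_iff field_simps)
    next
      fix j assume j: "j < N"
      have eq: "net (t P j) = net (t P' j)" using fun_cong[OF code(2), of j] j by (simp add: codeT_def)
      have "dist (t P j) (t P' j) \<le> dist (net (t P j)) (t P j) + dist (net (t P j)) (t P' j)"
        by (rule dist_triangle3)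
      also have "\<dots> \<le> r + r"
        using net(2)[OF t_ball[OF PP(1) j]] net(2)[OF t_ball[OF PP(2) j]] eq by (intro add_mono) auto
      finally show "norm (t P j - t P' j) \<le> 2 * r" by (simp add: dist_norm)
    next
      show "?s \<le> 1" unfolding s using u by simp
    qed (use \<epsilon> p in auto)
    moreover have "2 * \<rho> * ?s + real N * (2 * r) = 3 / 4 * \<Delta>"
      unfolding s using \<Delta> \<rho> N1 by (simp add: u_def r_def field_simps)
    ultimately show ?thesis by simp
  qed
  have inj: "inj_on (\<lambda>P. (codeF P, codeT P)) \<P>"
  proof (rule inj_onI, rule ccontr)
    fix P P' assume PP: "P \<in> \<P>" "P' \<in> \<P>" "(codeF P, codeT P) = (codeF P', codeT P')" "P \<noteq> P'"
    have "hausdorff_dist P P' \<le> 3 / 4 * \<Delta>"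
      using PP close[of P P'] close[of P' P] ne by (intro hausdorff_dist_le) auto
    then show False using sep[OF PP(1,2,4)] \<Delta> by linarith
  qed
  have codeF_mem: "codeF P \<in> K \<rightarrow>\<^sub>E Z" if "P \<in> \<P>" for P
  proof -
    have "\<lfloor>F P j i a b / \<epsilon>\<rfloor> \<in> Z" if "(j, i, a, b) \<in> K" for j i a b
    proof -
      have "\<bar>F P j i a b\<bar> \<le> real m" using that F_bound[OF \<open>P \<in> \<P>\<close>] by (simp add: K_def)
      then have "- real m / \<epsilon> \<le> F P j i a b / \<epsilon>" "F P j i a b / \<epsilon> \<le> real m / \<epsilon>"
        using \<epsilon> by (intro divide_right_mono; simp)+
      then show ?thesis unfolding Z_def by (simp add: floor_mono)
    qed
    then show ?thesis unfolding codeF_def by auto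
  qed
  have codeT_mem: "codeT P \<in> {..<N} \<rightarrow>\<^sub>E C" if "P \<in> \<P>" for P
    unfolding codeT_def using net(1) t_ball[OF that] by auto
  have fins: "finite (K \<rightarrow>\<^sub>E Z)" "finite ({..<N} \<rightarrow>\<^sub>E C)"
    using C(1) by (auto intro!: finite_PiE simp: K_def Z_def)
  have "card \<P> \<le> card ((K \<rightarrow>\<^sub>E Z) \<times> ({..<N} \<rightarrow>\<^sub>E C))"
    using codeF_mem codeT_mem fins by (intro card_inj_on_le[OF inj]) auto
  also have "\<dots> = card Z ^ card K * card C ^ N"
    by (simp add: card_cartesian_product card_PiE K_def)
  also have "card K = N * N" by (simp add: K_def N_def mult_ac)
  finally have "real (card \<P>) \<le> real (card Z) ^ (N * N) * real (card C) ^ N"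
    by (metis of_nat_le_iff of_nat_mult of_nat_power)
  also have "\<dots> \<le> (10 * u * real N ^ 3) ^ (N * N) * ((5 * real N * u) ^ CARD('d)) ^ N"
  proof (intro mult_mono power_mono)
    \<comment> \<open>One of the two extra cells comes from rounding down at the lower end, the
      other from counting both ends.\<close>
    have "real (card Z) \<le> 2 * (real m / \<epsilon>) + 2"
    proof -
      have "- (real m / \<epsilon>) - 1 < of_int \<lfloor>- real m / \<epsilon>\<rfloor>" "of_int \<lfloor>real m / \<epsilon>\<rfloor> \<le> real m / \<epsilon>" by linarith+
      moreover have "0 \<le> real m / \<epsilon>" using \<epsilon> by simp
      moreover have "real (card Z) = max 0 (of_int \<lfloor>real m / \<epsilon>\<rfloor> - of_int \<lfloor>- real m / \<epsilon>\<rfloor> + 1)"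
        unfolding Z_def by (simp add: nat_add_distrib)
      ultimately show ?thesis by linarith
    qed
    also have "real m / \<epsilon> = 4 * u * (real m * real N ^ 2)" by (simp add: \<epsilon>_def)
    also have "real m * real N ^ 2 \<le> real N * real N ^ 2" using mN by (intro mult_right_mono) auto
    also have "real N * real N ^ 2 = real N ^ 3" by (simp add: power3_eq_cube power2_eq_square)
    also have "2 * (4 * u * real N ^ 3) + 2 \<le> 10 * u * real N ^ 3"
    proof -
      have "1 * 1 \<le> u * real N ^ 3" using u N1 by (intro mult_mono) auto
      then show ?thesis by simp
    qed
    finally show "real (card Z) \<le> 10 * u * real N ^ 3" using u by (simp add: mult_left_mono)
    have "1 * 1 \<le> real N * u" using u N1 by (intro mult_mono) auto
    moreover have "1 + 2 * \<rho> / r = 1 + 4 * (real N * u)" using \<Delta> N1 by (simp add: r_def u_def)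
    ultimately have "1 + 2 * \<rho> / r \<le> 5 * real N * u" by linarith
    then have "(1 + 2 * \<rho> / r) ^ CARD('d) \<le> (5 * real N * u) ^ CARD('d)"
      using \<rho> r by (intro power_mono) auto
    then show "real (card C) \<le> (5 * real N * u) ^ CARD('d)" using C(2) by simp
  qed (use u in auto)
  finally show ?thesis .
qed

text \<open>For two distinct members of a separated family this yields \<Delta> \<le> 2\<rho>, so
  the logarithm of 2\<rho>/\<Delta> is nonnegative.\<close>

lemma hausdorff_dist_le_2:
  fixes X Y :: "(real ^ 'd) set"
  assumes "X \<noteq> {}" "Y \<noteq> {}" "X \<subseteq> cball 0 \<rho>" "Y \<subseteq> cball 0 \<rho>"
  shows "hausdorff_dist X Y \<le> 2 * \<rho>"
proof -
  have "dist x y \<le> 2 * \<rho>" if "x \<in> cball 0 \<rho>" "y \<in> cball 0 \<rho>" for x y :: "real ^ 'd"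
    using that dist_triangle2[of x y 0] by (simp add: dist_commute)
  then show ?thesis using assms by (intro hausdorff_dist_le) (blast | fastforce)+
qed

section \<open>From the count to the bound\<close>

text \<open>The exponents \<open>N * N\<close> and \<open>N * d\<close> are both at most
  \<open>d * N ^ 2\<close>. The factor 8 suffices because log 10 + log 5 = log 50 is at most log 256
  = 8.\<close>

lemma log_card_le:
  fixes u :: real and d N :: nat
  assumes bound: "k \<le> (10 * u * real N ^ 3) ^ (N * N) * ((5 * real N * u) ^ d) ^ N"
    and k: "2 \<le> k" and u: "1 \<le> u" and d: "1 \<le> d" and N: "1 \<le> N"
  shows "log 2 k \<le> 8 * real d * real N ^ 2 * (1 + log 2 u + log 2 (real N ^ 2))"
proof -
  have lu: "0 \<le> log 2 u" and lN: "0 \<le> log 2 (real N)" using u N by auto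
  let ?D = "real d * real N ^ 2"
  have "log 2 k \<le> log 2 ((10 * u * real N ^ 3) ^ (N * N) * ((5 * real N * u) ^ d) ^ N)"
    using bound k by (intro log_mono) auto
  also have "\<dots> = real (N * N) * log 2 (10 * u * real N ^ 3) + real N * (real d * log 2 (5 * real N * u))"
    using u N by (simp add: log_mult log_nat_power)
  also have "log 2 (10 * u * real N ^ 3) = log 2 10 + log 2 u + 3 * log 2 (real N)"
    using u N by (simp add: log_mult log_nat_power)
  also have "log 2 (5 * real N * u) = log 2 5 + log 2 (real N) + log 2 u"
    using u N by (simp add: log_mult)
  also have "real (N * N) * (log 2 10 + log 2 u + 3 * log 2 (real N)) +
      real N * (real d * (log 2 5 + log 2 (real N) + log 2 u)) \<le>
      ?D * (log 2 10 + log 2 u + 3 * log 2 (real N)) + ?D * (log 2 5 + log 2 (real N) + log 2 u)"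
  proof (rule add_mono)
    have "1 * real (N * N) \<le> real d * real (N * N)" using d by (intro mult_right_mono) auto
    then have "real (N * N) \<le> ?D" by (simp add: power2_eq_square)
    then show "real (N * N) * (log 2 10 + log 2 u + 3 * log 2 (real N)) \<le>
        ?D * (log 2 10 + log 2 u + 3 * log 2 (real N))"
      using lu lN by (intro mult_right_mono) auto
    have "real N * real d * 1 \<le> real N * real d * real N" using N by (intro mult_left_mono) auto
    then have "real N * real d \<le> ?D" by (simp add: power2_eq_square mult_ac)
    then have "(real N * real d) * (log 2 5 + log 2 (real N) + log 2 u) \<le>
        ?D * (log 2 5 + log 2 (real N) + log 2 u)"
      using lu lN by (intro mult_right_mono) auto
    then show "real N * (real d * (log 2 5 + log 2 (real N) + log 2 u)) \<le>
        ?D * (log 2 5 + log 2 (real N) + log 2 u)" by (simp only: mult.assoc)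
  qed
  also have "\<dots> = ?D * (log 2 10 + log 2 5 + 2 * log 2 u + 4 * log 2 (real N))"
    by (simp add: algebra_simps)
  also have "\<dots> \<le> ?D * (8 * (1 + log 2 u + log 2 (real N ^ 2)))"
  proof (intro mult_left_mono)
    have "log 2 (10 * 5 :: real) = log 2 10 + log 2 5" by (subst log_mult) auto
    then have "log 2 10 + log 2 5 = log 2 (50 :: real)" by simp
    also have "\<dots> \<le> log 2 (2 ^ 8)" by (intro log_mono) auto
    also have "log 2 (2 ^ 8 :: real) = 8" by (subst log_nat_power) auto
    finally have "log 2 10 + log 2 5 \<le> (8 :: real)" .
    moreover have "log 2 (real N ^ 2) = 2 * log 2 (real N)" using N by (simp add: log_nat_power)
    ultimately show "log 2 10 + log 2 5 + 2 * log 2 u + 4 * log 2 (real N) \<le>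
      8 * (1 + log 2 u + log 2 (real N ^ 2))" using lu lN by simp
  qed simp
  also have "\<dots> = 8 * real d * real N ^ 2 * (1 + log 2 u + log 2 (real N ^ 2))"
    by (simp only: mult_ac)
  finally show ?thesis .
qed

lemma block_ef_lower_bound:
  fixes \<P> :: "(real ^ 'd) set set"
  assumes lm: "1 \<le> l" "1 \<le> m" and fin: "finite \<P>" and card2: "2 \<le> card \<P>"
    and poly: "\<And>P. P \<in> \<P> \<Longrightarrow> polytope P"
    and dim: "\<And>P. P \<in> \<P> \<Longrightarrow> 1 \<le> aff_dim P"
    and ef: "\<And>P. P \<in> \<P> \<Longrightarrow> block_ef P l m"
    and \<rho>: "0 < \<rho>" and \<Delta>: "0 < \<Delta>"
    and ball: "\<And>P. P \<in> \<P> \<Longrightarrow> P \<subseteq> cball 0 \<rho>"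
    and sep: "\<And>P P'. P \<in> \<P> \<Longrightarrow> P' \<in> \<P> \<Longrightarrow> P \<noteq> P' \<Longrightarrow> \<Delta> \<le> hausdorff_dist P P'"
  shows "log 2 (real (card \<P>)) / (8 * real CARD('d) *
      (1 + log 2 (2 * \<rho> / \<Delta>) + log 2 (log 2 (real (card \<P>))))) \<le> real l ^ 2 * real m ^ 4"
proof -
  define N where "N = l * m * m"
  define L where "L = log 2 (real (card \<P>))"
  define u where "u = 2 * \<rho> / \<Delta>"
  have ne: "P \<noteq> {}" if "P \<in> \<P>" for P using dim[OF that] by auto
  have N1: "1 \<le> N" using lm by (simp add: N_def)
  have N2: "real l ^ 2 * real m ^ 4 = real N ^ 2" by (simp add: N_def power2_eq_square power4_eq_xxxx)
  have "log 2 2 \<le> L" unfolding L_def using card2 by (intro log_mono) auto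
  then have L1: "1 \<le> L" by simp
  have "\<not> (\<exists>P. \<P> \<subseteq> {P})"
  proof
    assume "\<exists>P. \<P> \<subseteq> {P}"
    then obtain P where "\<P> \<subseteq> {P}" by blast
    then have "card \<P> \<le> card {P}" by (intro card_mono) auto
    then show False using card2 by simp
  qed
  then obtain P P' where PP: "P \<in> \<P>" "P' \<in> \<P>" "P \<noteq> P'" by blast
  have "\<Delta> \<le> 2 * \<rho>"
    using sep[OF PP] hausdorff_dist_le_2[OF ne[OF PP(1)] ne[OF PP(2)] ball[OF PP(1)] ball[OF PP(2)]] by simp
  then have u: "1 \<le> u" using \<Delta> by (simp add: u_def)
  define den where "den = 8 * real CARD('d) * (1 + log 2 u + log 2 L)"
  have d: "1 \<le> CARD('d)" by (simp add: Suc_le_eq)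
  have logs: "0 \<le> log 2 u" "0 \<le> log 2 L" using u L1 by auto
  have "8 * 1 * 1 \<le> den" unfolding den_def using d logs by (intro mult_mono) auto
  then have den: "1 \<le> den" by simp
  have "L / den \<le> real N ^ 2"
  \<comment> \<open>If \<open>L\<close> is at most \<open>N ^ 2\<close>, the bound holds since the
    denominator is at least 1. Otherwise the term log \<open>N ^ 2\<close> in the counting estimate
    may be replaced by log \<open>L\<close>.\<close>
  proof (cases "L \<le> real N ^ 2")
    case True
    have "L / den \<le> L / 1" using den L1 by (intro divide_left_mono) auto
    then show ?thesis using True by simp
  next
    case False
    have "\<forall>P\<in>\<P>. \<exists>tF. normalized_ef P l m N (fst tF) (snd tF)"
    proof
      fix P assume P: "P \<in> \<P>"
      obtain t F where "normalized_ef P l m N t F"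
        using normalized_ef_exists[OF poly[OF P] dim[OF P] ef[OF P] lm] unfolding N_def by blast
      then show "\<exists>tF. normalized_ef P l m N (fst tF) (snd tF)" by (intro exI[of _ "(t, F)"]) simp
    qed
    then obtain tF where tF: "\<forall>P\<in>\<P>. normalized_ef P l m N (fst (tF P)) (snd (tF P))"
      unfolding bchoice_iff by (elim exE) (rule that)
    have "real (card \<P>) \<le> (10 * u * real N ^ 3) ^ (N * N) * ((5 * real N * u) ^ CARD('d)) ^ N"
      unfolding N_def u_def
      by (rule card_separated_normalized_ef[OF lm fin tF[unfolded N_def, rule_format] ne ball \<rho> \<Delta> \<open>\<Delta> \<le> 2 * \<rho>\<close> sep])
    then have "L \<le> 8 * real CARD('d) * real N ^ 2 * (1 + log 2 u + log 2 (real N ^ 2))"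
      unfolding L_def using card2 u d N1 by (intro log_card_le) auto
    also have "\<dots> \<le> 8 * real CARD('d) * real N ^ 2 * (1 + log 2 u + log 2 L)"
      using False N1 by (intro mult_left_mono add_left_mono log_mono) auto
    also have "\<dots> = real N ^ 2 * den" by (simp add: den_def mult_ac)
    finally show ?thesis using den by (simp add: pos_divide_le_eq)
  qed
  then show ?thesis unfolding N2 L_def den_def u_def .
qed

section \<open>Extension complexities and the conclusion\<close>

lemma not_singleton_if_aff_dim_ge_1: "1 \<le> aff_dim P \<Longrightarrow> \<not> (P = {} \<or> (\<exists>p. P = {p}))"
  by auto

lemma sxc_block_ef:
  assumes dim: "1 \<le> aff_dim P" and ef: "has_ef_LMI P k" "1 \<le> k"
  shows "1 \<le> sxc P" "block_ef P 1 (sxc P)"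
proof -
  have "sxc P = (LEAST k. 1 \<le> k \<and> has_ef_LMI P k)"
    unfolding sxc_def if_not_P[OF not_singleton_if_aff_dim_ge_1[OF dim]] ..
  then have "1 \<le> sxc P \<and> has_ef_LMI P (sxc P)"
    using LeastI[of "\<lambda>k. 1 \<le> k \<and> has_ef_LMI P k" k] ef by simp
  then show "1 \<le> sxc P" "block_ef P 1 (sxc P)" by (simp_all add: has_ef_LMI_iff)
qed

text \<open>The formulations assumed for the family have arbitrary block size, so the candidate for
  the minimum comes from \<open>polytope_has_linear_ef\<close>.\<close>

lemma xc_block_ef:
  assumes dim: "1 \<le> aff_dim P" and poly: "polytope P"
  shows "1 \<le> xc P" "block_ef P (xc P) 1"
proof -
  have "P \<noteq> {}" using dim by auto
  then obtain l where l: "1 \<le> l" "block_ef P l 1" using polytope_has_linear_ef[OF poly] by blast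
  have "xc P = (LEAST l. 1 \<le> l \<and> has_ef_LMIs P l 1)"
    unfolding xc_def if_not_P[OF not_singleton_if_aff_dim_ge_1[OF dim]] ..
  then have "1 \<le> xc P \<and> has_ef_LMIs P (xc P) 1"
    using LeastI[of "\<lambda>l. 1 \<le> l \<and> has_ef_LMIs P l 1" l] l by (simp add: has_ef_LMIs_iff)
  then show "1 \<le> xc P" "block_ef P (xc P) 1" by (simp_all add: has_ef_LMIs_iff)
qed

theorem theorem1:
  fixes \<P> :: "(real ^ 'd) set set" and l m :: nat and \<rho> \<Delta> :: real
  assumes "1 \<le> l" and "1 \<le> m"
    and "finite \<P>" and "2 \<le> card \<P>"
    and "\<And>P. P \<in> \<P> \<Longrightarrow> polytope P"
    and "\<And>P. P \<in> \<P> \<Longrightarrow> 1 \<le> aff_dim P"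
    and "\<And>P. P \<in> \<P> \<Longrightarrow> has_ef_LMIs P l m"
    and "0 < \<rho>" and "0 < \<Delta>"
    and "\<And>P. P \<in> \<P> \<Longrightarrow> P \<subseteq> cball 0 \<rho>"
    and "\<And>P P'. P \<in> \<P> \<Longrightarrow> P' \<in> \<P> \<Longrightarrow> P \<noteq> P' \<Longrightarrow> \<Delta> \<le> hausdorff_dist P P'"
  shows "let B = log 2 (real (card \<P>)) /
                  (8 * real CARD('d) *
                    (1 + log 2 (2 * \<rho> / \<Delta>) + log 2 (log 2 (real (card \<P>)))))
         in real l ^ 2 * real m ^ 4 \<ge> B \<and>
            real (Max (sxc ` \<P>)) \<ge> root 4 B \<and>
            real (Max (xc ` \<P>)) \<ge> sqrt B"
proof -
  define B where "B = log 2 (real (card \<P>)) / (8 * real CARD('d) *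
    (1 + log 2 (2 * \<rho> / \<Delta>) + log 2 (log 2 (real (card \<P>)))))"
  define s where "s = Max (sxc ` \<P>)"
  define x where "x = Max (xc ` \<P>)"
  \<comment> \<open>Used for three pairs: the given \<open>l\<close> and \<open>m\<close>, one block
    of the maximal size \<open>s\<close>, and \<open>x\<close> blocks of size 1.\<close>
  have lower: "B \<le> real l' ^ 2 * real m' ^ 4"
    if "1 \<le> l'" "1 \<le> m'" "\<And>P. P \<in> \<P> \<Longrightarrow> block_ef P l' m'" for l' m'
    unfolding B_def
    by (rule block_ef_lower_bound[OF that(1,2) assms(3-6) that(3) assms(8-11)])
  obtain P0 where P0: "P0 \<in> \<P>" using assms(4) by fastforce
  have sxc: "1 \<le> sxc P" "block_ef P 1 (sxc P)" if "P \<in> \<P>" for P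
    using sxc_block_ef[OF assms(6)[OF that] has_ef_LMIs_imp_has_ef_LMI[OF assms(7)[OF that]]] assms(1,2)
    by auto
  have s_ge: "sxc P \<le> s" if "P \<in> \<P>" for P unfolding s_def using that assms(3) by simp
  have "B \<le> real 1 ^ 2 * real s ^ 4"
  proof (rule lower)
    show "1 \<le> s" using sxc(1)[OF P0] s_ge[OF P0] by simp
    show "block_ef P 1 s" if "P \<in> \<P>" for P
      using block_ef_mono_size[OF sxc(2)[OF that] s_ge[OF that]] .
  qed simp
  then have "root 4 B \<le> root 4 (real s ^ 4)" by (intro real_root_le_mono) auto
  then have s: "root 4 B \<le> real s" by (simp add: real_root_power_cancel)
  have xc: "1 \<le> xc P" "block_ef P (xc P) 1" if "P \<in> \<P>" for P
    using xc_block_ef[OF assms(6)[OF that] assms(5)[OF that]] .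
  have x_ge: "xc P \<le> x" if "P \<in> \<P>" for P unfolding x_def using that assms(3) by simp
  have "B \<le> real x ^ 2 * real 1 ^ 4"
  proof (rule lower)
    show "1 \<le> x" using xc(1)[OF P0] x_ge[OF P0] by simp
    show "block_ef P x 1" if "P \<in> \<P>" for P
      using block_ef_mono_number[OF xc(2)[OF that] x_ge[OF that]] .
  qed simp
  then have x: "sqrt B \<le> real x" by (intro real_le_lsqrt) auto
  have "B \<le> real l ^ 2 * real m ^ 4"
    using assms(1,2,7) by (intro lower) (auto simp: has_ef_LMIs_iff)
  then show ?thesis
    unfolding Let_def B_def[symmetric] s_def[symmetric] x_def[symmetric] using s x by simp
qed

end
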